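(* Let $P_1,\dots,P_r$ be first order differential operators with smooth complex coefficients on an open set $\Omega\subseteq\mathbb{R}^n$ satisfying (A1) and (A2) below, and let $\mathcal{P}_1,\dots,\mathcal{P}_r$ be the associated differential operators defined in the context, with $\mathcal{P}_{r+1}:=0$. Then $\mathcal{P}_{q+1}\circ\mathcal{P}_q=0$ for every $1\le q\le r$; that is, for every open $U\subseteq\Omega$ and every $f\in L^2_{loc}(U)^{\oplus\binom{r}{q-1}}$ one has $\mathcal{P}_{q+1}(\mathcal{P}_qf)=0$ on $U$ (in the sense of distributions).
   Context: Let $P_j=\sum_{\nu=1}^n a_j^\nu\partial_\nu+a_j^0$ ($1\le j\le r$), $a_j^\nu\in C^\infty(\Omega)$ complex valued, $\partial_\nu=\partial/\partial x_\nu$; the principal part of $P_j$ is $p_j=\sum_{\nu=1}^n a_j^\nu\partial_\nu$. Repeated indices are summed. (A1) There are complex valued functions $c_{jk}^l\in C^\infty(\Omega)$ ($1\le j,k,l\le r$) with $[P_j,P_k]=P_jP_k-P_kP_j=c_{jk}^lP_l$ and $c_{jk}^l=-c_{kj}^l$. (A2) For all $1\le k,l,k',l'\le r$: $c_{kk'}^sc_{sl'}^l+c_{k'l'}^sc_{sk}^l+c_{l'k}^sc_{sk'}^l=p_{l'}c_{kk'}^l+p_kc_{k'l'}^l+p_{k'}c_{l'k}^l$. Multi-index conventions: multi-indices have entries in $\{1,\dots,r\}$. An element of a space $V^{\oplus\binom{r}{q}}$ is written $f=(f_J)_{|J|=q}$, where $f_J$ is antisymmetric in the entries of $J$; it is determined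 by the $f_J$ with $J$ strictly increasing (of length $|J|=q$). For $J$ strictly increasing and $j\in J$, $J\setminus j$ is the strictly increasing multi-index with entries $J\setminus\{j\}$ (similarly $J\setminus\{m,n\}$), and $(j,J\setminus j)$ is the number of entries of $J\setminus j$ smaller than $j$; $sJ$ denotes the (not necessarily ordered) multi-index $(s,j_1,\dots,j_q)$; $\mathrm{sgn}\binom{J}{mnJ\setminus\{m,n\}}$ is the sign of the permutation taking $J$ to $(m,n,J\setminus\{m,n\})$. For $1\le q\le r$ and $f=(f_I)_{|I|=q-1}$, define $$(\mathcal{P}_qf)_J=\sum_{j\in J}(-1)^{(j,J\setminus j)}P_jf_{J\setminus j}-\sum_{m<n;\ m,n\in J}\mathrm{sgn}\tbinom{J}{mnJ\setminus\{m,n\}}\,c_{mn}^s\,f_{sJ\setminus\{m,n\}}$$ for $J$ strictly increasing with $|J|=q$ (sum over $s=1,\dots,r$ understood). In particular $\mathcal{P}_1u=(P_1u,\dots,P_ru)$. Derivatives are taken in the sense of distributions. *)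

theory Defs
  imports "HOL-Analysis.Analysis" "HOL-Combinatorics.Permutations"
begin

section \<open>Smooth functions\<close>

definition partial :: "'n::finite \<Rightarrow> (real^'n \<Rightarrow> complex) \<Rightarrow> real^'n \<Rightarrow> complex" where
  "partial \<nu> u x = vector_derivative (\<lambda>t. u (x + t *\<^sub>R axis \<nu> 1)) (at 0)"

primrec Ck_on :: "nat \<Rightarrow> (real^'n) set \<Rightarrow> (real^'n \<Rightarrow> complex) \<Rightarrow> bool" where
  "Ck_on 0 S u \<longleftrightarrow> continuous_on S u"
| "Ck_on (Suc k) S u \<longleftrightarrow> u differentiable_on S \<and> (\<forall>\<nu>. Ck_on k S (partial \<nu> u))"

text \<open>The class \<open>C\<^sup>\<infinity>(S)\<close>, to be used for open \<open>S\<close> only.\<close>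

definition smooth_on :: "(real^'n) set \<Rightarrow> (real^'n \<Rightarrow> complex) \<Rightarrow> bool" where
  "smooth_on S u \<longleftrightarrow> (\<forall>k. Ck_on k S u)"

section \<open>First order operators on functions\<close>

text \<open>The operator \<open>P\<^sub>j = \<Sum>\<^sub>\<nu> a\<^sub>j\<^sup>\<nu> \<partial>\<^sub>\<nu> + a\<^sub>j\<^sup>0\<close> has first order coefficients \<open>a j \<nu>\<close>
  and zeroth order coefficient \<open>a0 j\<close>.\<close>

definition principal_op ::
    "(nat \<Rightarrow> 'n::finite \<Rightarrow> real^'n \<Rightarrow> complex) \<Rightarrow> nat \<Rightarrow> (real^'n \<Rightarrow> complex) \<Rightarrow> real^'n \<Rightarrow> complex" where
  "principal_op a j u x = (\<Sum>\<nu>\<in>UNIV. a j \<nu> x * partial \<nu> u x)"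

definition diff_op ::
    "(nat \<Rightarrow> 'n::finite \<Rightarrow> real^'n \<Rightarrow> complex) \<Rightarrow> (nat \<Rightarrow> real^'n \<Rightarrow> complex) \<Rightarrow>
     nat \<Rightarrow> (real^'n \<Rightarrow> complex) \<Rightarrow> real^'n \<Rightarrow> complex" where
  "diff_op a a0 j u x = principal_op a j u x + a0 j x * u x"

section \<open>Distributions\<close>

text \<open>A distribution on \<open>U\<close> is represented by its values on \<open>test_functions U\<close>; what the
  functional does with other arguments is irrelevant, and equality on \<open>U\<close> means equality on
  \<open>test_functions U\<close>.  The operations below are the usual ones on \<open>\<D>'(U)\<close>; they are written
  without a continuity requirement because their formulas do not involve it, and they are only
  ever applied, repeatedly, to distributions given by locally square integrable functions.\<close>

type_synonym 'n functional = "(real^'n \<Rightarrow> complex) \<Rightarrow> complex"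

definition test_functions :: "(real^'n) set \<Rightarrow> (real^'n \<Rightarrow> complex) set" where
  "test_functions U = {\<phi>. smooth_on UNIV \<phi> \<and>
     compact (closure {x. \<phi> x \<noteq> 0}) \<and> closure {x. \<phi> x \<noteq> 0} \<subseteq> U}"

definition dist_partial :: "'n::finite \<Rightarrow> 'n functional \<Rightarrow> 'n functional" where
  "dist_partial \<nu> T = (\<lambda>\<phi>. - T (partial \<nu> \<phi>))"

text \<open>If \<open>g\<close> is smooth on an open set containing \<open>U\<close> and \<open>\<phi> \<in> test_functions U\<close>, then
  \<open>g \<phi> \<in> test_functions U\<close> whatever the values of \<open>g\<close> outside \<open>U\<close>.\<close>

definition dist_mult :: "(real^'n::finite \<Rightarrow> complex) \<Rightarrow> 'n functional \<Rightarrow> 'n functional" where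
  "dist_mult g T = (\<lambda>\<phi>. T (\<lambda>x. g x * \<phi> x))"

definition dist_diff_op ::
    "(nat \<Rightarrow> 'n::finite \<Rightarrow> real^'n \<Rightarrow> complex) \<Rightarrow> (nat \<Rightarrow> real^'n \<Rightarrow> complex) \<Rightarrow>
     nat \<Rightarrow> 'n functional \<Rightarrow> 'n functional" where
  "dist_diff_op a a0 j T =
     (\<lambda>\<phi>. (\<Sum>\<nu>\<in>UNIV. dist_mult (a j \<nu>) (dist_partial \<nu> T) \<phi>) + dist_mult (a0 j) T \<phi>)"

definition L2_loc :: "(real^'n) set \<Rightarrow> (real^'n \<Rightarrow> complex) set" where
  "L2_loc U = {f. f \<in> borel_measurable (lebesgue_on U) \<and>
     (\<forall>K. compact K \<and> K \<subseteq> U \<longrightarrow> integrable (lebesgue_on K) (\<lambda>x. (norm (f x))\<^sup>2))}"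

definition dist_of_fun :: "(real^'n::finite) set \<Rightarrow> (real^'n \<Rightarrow> complex) \<Rightarrow> 'n functional" where
  "dist_of_fun U f = (\<lambda>\<phi>. integral\<^sup>L (lebesgue_on U) (\<lambda>x. f x * \<phi> x))"

section \<open>Multi-indices and antisymmetric families\<close>

definition multi_indices :: "nat \<Rightarrow> nat \<Rightarrow> nat list set" where
  "multi_indices r q = {I. length I = q \<and> set I \<subseteq> {1..r}}"

text \<open>The sign of the permutation taking \<open>J\<close> to \<open>K\<close>; meaningful if \<open>J\<close> has distinct entries
  and \<open>K\<close> is a rearrangement of \<open>J\<close>.\<close>

definition sgn_perm :: "nat list \<Rightarrow> nat list \<Rightarrow> int" where
  "sgn_perm J K = sign (THE p. p permutes {..<length J} \<and> permute_list p J = K)"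

text \<open>Elements of \<open>L\<^sup>2\<^sub>l\<^sub>o\<^sub>c(U)\<close> are functions up to null sets, hence antisymmetry almost
  everywhere.\<close>

definition L2_loc_families :: "(real^'n) set \<Rightarrow> nat \<Rightarrow> nat \<Rightarrow> (nat list \<Rightarrow> real^'n \<Rightarrow> complex) set" where
  "L2_loc_families U r q = {f. \<forall>I\<in>multi_indices r q. f I \<in> L2_loc U \<and>
     (\<forall>p. p permutes {..<q} \<longrightarrow>
        (AE x in lebesgue_on U. f (permute_list p I) x = of_int (sign p) * f I x))}"

section \<open>The operators \<open>\<P>\<^sub>q\<close>\<close>

definition list_minus :: "nat list \<Rightarrow> nat set \<Rightarrow> nat list" where
  "list_minus J A = filter (\<lambda>i. i \<notin> A) J"

text \<open>The component \<open>(\<P>\<^sub>q F)\<^sub>J\<close> for strictly increasing \<open>J\<close>, where \<open>c j k l\<close> stands for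
  \<open>c\<^sub>j\<^sub>k\<^sup>l\<close>.\<close>

definition complex_op_incr ::
    "nat \<Rightarrow> (nat \<Rightarrow> 'n::finite \<Rightarrow> real^'n \<Rightarrow> complex) \<Rightarrow> (nat \<Rightarrow> real^'n \<Rightarrow> complex) \<Rightarrow>
     (nat \<Rightarrow> nat \<Rightarrow> nat \<Rightarrow> real^'n \<Rightarrow> complex) \<Rightarrow>
     (nat list \<Rightarrow> 'n functional) \<Rightarrow> nat list \<Rightarrow> 'n functional" where
  "complex_op_incr r a a0 c F J = (\<lambda>\<phi>.
     (\<Sum>j\<in>set J. (-1) ^ card {i \<in> set J - {j}. i < j} *
        dist_diff_op a a0 j (F (list_minus J {j})) \<phi>)
     - (\<Sum>(m, n) \<in> {(m, n). m \<in> set J \<and> n \<in> set J \<and> m < n}.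
          of_int (sgn_perm J (m # n # list_minus J {m, n})) *
          (\<Sum>s=1..r. dist_mult (c m n s) (F (s # list_minus J {m, n})) \<phi>)))"

text \<open>The value at arbitrary multi-indices is the antisymmetric extension of the values at
  strictly increasing ones; for \<open>q > r\<close> the operator is zero.\<close>

definition complex_op ::
    "nat \<Rightarrow> (nat \<Rightarrow> 'n::finite \<Rightarrow> real^'n \<Rightarrow> complex) \<Rightarrow> (nat \<Rightarrow> real^'n \<Rightarrow> complex) \<Rightarrow>
     (nat \<Rightarrow> nat \<Rightarrow> nat \<Rightarrow> real^'n \<Rightarrow> complex) \<Rightarrow> nat \<Rightarrow>
     (nat list \<Rightarrow> 'n functional) \<Rightarrow> nat list \<Rightarrow> 'n functional" where
  "complex_op r a a0 c q F L =
     (if q \<le> r \<and> L \<in> multi_indices r q \<and> distinct L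
      then (\<lambda>\<phi>. of_int (sgn_perm (sort L) L) * complex_op_incr r a a0 c F (sort L) \<phi>)
      else (\<lambda>\<phi>. 0))"

end

theory Submission
  imports Defs "HOL-Library.Function_Algebras"
begin

text \<open>The coefficients define a Lie algebroid structure on the trivial bundle with frame
  \<open>e\<^sub>1, \<dots>, e\<^sub>r\<close>, anchor \<open>e\<^sub>j \<mapsto> p\<^sub>j\<close> and bracket \<open>[e\<^sub>j, e\<^sub>k] = c\<^sub>j\<^sub>k\<^sup>l e\<^sub>l\<close>; (A1) says that
  the \<open>P\<^sub>j\<close> form a representation, (A2) is the Jacobi identity, and \<open>\<P>\<^sub>q\<close> is the
  Chevalley--Eilenberg differential \<open>d\<close>.  Cartan's formula \<open>\<iota>\<^sub>j d = L\<^sub>j - d \<iota>\<^sub>j\<close> characterizes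
  \<open>d\<close> recursively, and reduces \<open>d d = 0\<close> to \<open>[L\<^sub>j, d] = 0\<close>, which in turn follows by induction
  from the formula for \<open>[L\<^sub>j, L\<^sub>k]\<close>.  On distributions the operators are transposed to
  test functions; there (A1), stated for functions, is recovered from the coefficient identities
  obtained by applying it to \<open>1\<close> and to the coordinate functions.\<close>

section \<open>The Chevalley--Eilenberg differential\<close>

text \<open>The obstacle is that the structure functions are not constant. Along
  \<open>c\<^sub>j\<^sub>k\<^sup>s e\<^sub>s\<close> the Lie derivative is not just
  \<open>c\<^sub>j\<^sub>k\<^sup>s L\<^sub>s\<close>, but picks up the wedge product of
  \<open>dc\<^sub>j\<^sub>k\<^sup>s\<close> with the contraction by \<open>e\<^sub>s\<close>. The
  differential is not linear over functions either and produces the same wedge product;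
  \<open>[L\<^sub>j, d] = 0\<close> holds because the two corrections coincide. The recursion runs
  over arbitrary lists of indices rather than increasing ones, so that a contraction is merely a
  \<open>Cons\<close> and the signs of the explicit formula enter only once, when \<open>D\<close>
  is compared with it on sorted lists. Antisymmetry is accordingly expressed by adjacent swaps,
  which generate all permutations and survive the fixing of a first entry. Values lie in an abstract
  abelian group; functions act on it through the operators \<open>C\<close> and
  \<open>E\<close>.\<close>

definition alternating :: "(nat list \<Rightarrow> 'v::ab_group_add) \<Rightarrow> bool" where
  "alternating F \<longleftrightarrow> (\<forall>A x y B. F (A @ x # y # B) = - F (A @ y # x # B))"

lemma alternating_swap: "alternating F \<Longrightarrow> F (A @ x # y # B) = - F (A @ y # x # B)"
  unfolding alternating_def by blast

lemma alternating_swap0: "alternating F \<Longrightarrow> F (x # y # B) = - F (y # x # B)"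
  using alternating_swap[of F "[]" x y B] by (simp only: append_Nil)

lemma alternating_Cons: "alternating F \<Longrightarrow> alternating (\<lambda>K. F (x # K))"
  unfolding alternating_def by (metis append_Cons)

lemma sum_fun_eq: "(\<Sum>s\<in>A. f s) = (\<lambda>K. \<Sum>s\<in>A. f s K)"
  by (rule ext) (induction A rule: infinite_finite_induct; simp)

text \<open>\<open>C j k s\<close> and \<open>E i j k s\<close> stand for multiplication by \<open>c\<^sub>j\<^sub>k\<^sup>s\<close> and by \<open>p\<^sub>i c\<^sub>j\<^sub>k\<^sup>s\<close>.  The set
  \<open>V\<close> is needed because the laws below hold only for functionals that are additive on test
  functions.\<close>

locale lie_algebroid_rep =
  fixes r :: nat
    and P :: "nat \<Rightarrow> 'v::ab_group_add \<Rightarrow> 'v"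
    and C :: "nat \<Rightarrow> nat \<Rightarrow> nat \<Rightarrow> 'v \<Rightarrow> 'v"
    and E :: "nat \<Rightarrow> nat \<Rightarrow> nat \<Rightarrow> nat \<Rightarrow> 'v \<Rightarrow> 'v"
    and V :: "'v set"
  assumes additive_P: "Modules.additive (P j)"
    and additive_C: "Modules.additive (C j k s)"
    and additive_E: "Modules.additive (E i j k s)"
    and C_commute: "C j k s (C j' k' s' v) = C j' k' s' (C j k s v)"
    and C_antisym: "v \<in> V \<Longrightarrow> C j k s v = - C k j s v"
    and Leibniz: "v \<in> V \<Longrightarrow> P i (C j k s v) = C j k s (P i v) + E i j k s v"
    and P_commutator: "v \<in> V \<Longrightarrow> P j (P k v) - P k (P j v) = (\<Sum>s=1..r. C j k s (P s v))"
    \<comment> \<open>(A2) for the indices \<open>j\<close>, \<open>k\<close>, \<open>m\<close>,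
      with antisymmetry used to reach the shape of double brackets that the commutator of two Lie
      derivatives produces.\<close>
    and Jacobi: "v \<in> V \<Longrightarrow>
      (\<Sum>s=1..r. C j k s (C s m l v)) + (\<Sum>s=1..r. C j m s (C k s l v))
        - (\<Sum>s=1..r. C k m s (C j s l v))
      = E m j k l v + E j k m l v - E k j m l v"
begin

lemmas P_simps = Modules.additive.diff[OF additive_P] Modules.additive.add[OF additive_P]
  Modules.additive.minus[OF additive_P] Modules.additive.zero[OF additive_P] Modules.additive.sum[OF additive_P]
lemmas C_simps = Modules.additive.diff[OF additive_C] Modules.additive.add[OF additive_C]
  Modules.additive.minus[OF additive_C] Modules.additive.zero[OF additive_C] Modules.additive.sum[OF additive_C]
lemmas E_simps = Modules.additive.diff[OF additive_E] Modules.additive.add[OF additive_E]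
  Modules.additive.minus[OF additive_E] Modules.additive.zero[OF additive_E] Modules.additive.sum[OF additive_E]

text \<open>The Lie derivative along \<open>e\<^sub>j\<close>: the summand for \<open>i\<close>
  inserts into slot \<open>i\<close> the bracket of \<open>e\<^sub>j\<close> with the frame element
  of index \<open>I ! i\<close>.\<close>

definition Lie :: "nat \<Rightarrow> (nat list \<Rightarrow> 'v) \<Rightarrow> nat list \<Rightarrow> 'v" where
  "Lie j F I = P j (F I) - (\<Sum>i<length I. \<Sum>s=1..r. C j (I ! i) s (F (I[i := s])))"

text \<open>The argument \<open>\<lambda>K. F (j # K)\<close> is the contraction \<open>\<iota>\<^sub>j F\<close>, so the second equation is Cartan's formula.\<close>

primrec D :: "nat list \<Rightarrow> (nat list \<Rightarrow> 'v) \<Rightarrow> 'v" where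
  "D [] F = 0"
| "D (j # I) F = Lie j F I - D I (\<lambda>K. F (j # K))"

text \<open>\<open>d_wedge I j k s F\<close> is the component \<open>(dc\<^sub>j\<^sub>k\<^sup>s \<and> F)\<^sub>I\<close>.\<close>

primrec d_wedge :: "nat list \<Rightarrow> nat \<Rightarrow> nat \<Rightarrow> nat \<Rightarrow> (nat list \<Rightarrow> 'v) \<Rightarrow> 'v" where
  "d_wedge [] j k s F = 0"
| "d_wedge (x # I) j k s F = E x j k s (F I) - d_wedge I j k s (\<lambda>K. F (x # K))"

text \<open>Slot 0 is split off: \<open>L\<^sub>j\<close> commutes with the contraction by
  \<open>e\<^sub>k\<close> up to the contraction by \<open>[e\<^sub>j, e\<^sub>k]\<close>.\<close>

lemma Lie_Cons: "Lie j F (k # I) = Lie j (\<lambda>K. F (k # K)) I - (\<Sum>s=1..r. C j k s (F (s # I)))"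
  by (simp add: Lie_def sum.lessThan_Suc_shift del: sum.lessThan_Suc)

lemma Lie_diff: "Lie j (\<lambda>K. F K - G K) I = Lie j F I - Lie j G I"
  by (simp add: Lie_def P_simps C_simps sum_subtractf)

lemma D_diff: "D I (\<lambda>K. F K - G K) = D I F - D I G"
  by (induction I arbitrary: F G) (simp_all add: Lie_diff)

lemma additive_D: "Modules.additive (D I)"
proof
  show "D I (F + G) = D I F + D I G" for F G
  proof -
    have "D I (\<lambda>K. 0) = 0" using D_diff[of I "\<lambda>_. 0" "\<lambda>_. 0"] by simp
    then have "D I (\<lambda>K. - G K) = - D I G" using D_diff[of I "\<lambda>_. 0" G] by simp
    then show ?thesis using D_diff[of I F "\<lambda>K. - G K"] by (simp add: plus_fun_def)
  qed
qed

lemma D_minus: "D I (\<lambda>K. - F K) = - D I F"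
  using Modules.additive.minus[OF additive_D, of I F] by (simp add: fun_Compl_def)

lemma D_sum: "D I (\<lambda>K. \<Sum>s\<in>A. F s K) = (\<Sum>s\<in>A. D I (F s))"
  using Modules.additive.sum[OF additive_D, of I F A] by (simp add: sum_fun_eq)

lemma d_wedge_minus: "d_wedge I j k s (\<lambda>K. - F K) = - d_wedge I j k s F"
  by (induction I arbitrary: F) (simp_all add: E_simps)

lemma Lie_C:
  assumes "\<And>K. F K \<in> V"
  shows "Lie x (\<lambda>K. C j k s (F K)) I = C j k s (Lie x F I) + E x j k s (F I)"
  by (simp add: Lie_def C_simps Leibniz[OF assms] C_commute[of _ _ _ j k s])

text \<open>The product rule d(cF) = c dF + dc wedge F. Each level of the recursion contributes one
  derivative of c through \<open>Lie_C\<close>.\<close>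

lemma D_C:
  assumes "\<And>K. F K \<in> V"
  shows "D I (\<lambda>K. C j k s (F K)) = C j k s (D I F) + d_wedge I j k s F"
  using assms
  by (induction I arbitrary: F) (simp_all add: C_simps Lie_C)

text \<open>Moving \<open>s\<close> from the front into slot \<open>i\<close> costs the sign (-1)^i,
  which is also the sign of the corresponding term in the recursion of \<open>d_wedge\<close>; so no
  signs remain.\<close>

lemma d_wedge_alternating:
  assumes "alternating F"
  shows "d_wedge I j k s (\<lambda>K. F (s # K)) = (\<Sum>i<length I. E (I ! i) j k s (F (I[i := s])))"
  using assms
proof (induction I arbitrary: F)
  case (Cons x I)
  have "(\<lambda>K. F (s # x # K)) = (\<lambda>K. - F (x # s # K))"
    using alternating_swap0[OF Cons.prems] by blast
  then show ?case
    using Cons.IH[OF alternating_Cons[OF Cons.prems, of x]]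
    by (simp add: sum.lessThan_Suc_shift d_wedge_minus del: sum.lessThan_Suc)
qed simp

text \<open>The two brackets act either in different slots or successively in the same slot. The
  first kind is symmetric in \<open>j\<close> and \<open>k\<close>; the second feeds the Jacobi
  identity.\<close>

lemma Lie_Lie:
  assumes F: "\<And>K. F K \<in> V"
  shows "Lie j (Lie k F) I = P j (P k (F I))
    - (\<Sum>i<length I. \<Sum>s=1..r. C k (I!i) s (P j (F (I[i:=s]))) + E j k (I!i) s (F (I[i:=s])))
    - (\<Sum>i<length I. \<Sum>s=1..r. C j (I!i) s (P k (F (I[i:=s]))))
    + (\<Sum>i<length I. \<Sum>i'\<in>{..<length I} - {i}. \<Sum>s=1..r. \<Sum>s'=1..r.
         C j (I!i) s (C k (I!i') s' (F (I[i:=s, i':=s']))))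
    + (\<Sum>i<length I. \<Sum>l=1..r. \<Sum>s=1..r. C j (I!i) s (C k s l (F (I[i:=l]))))"
proof -
  let ?n = "length I"
  have "(\<Sum>s=1..r. C j (I!i) s (\<Sum>i'<?n. \<Sum>s'=1..r. C k (I[i:=s]!i') s' (F (I[i:=s, i':=s']))))
      = (\<Sum>i'\<in>{..<?n} - {i}. \<Sum>s=1..r. \<Sum>s'=1..r.
         C j (I!i) s (C k (I!i') s' (F (I[i:=s, i':=s']))))
       + (\<Sum>l=1..r. \<Sum>s=1..r. C j (I!i) s (C k s l (F (I[i:=l]))))" (is "?L i = ?Q i + ?R i")
    if "i < ?n" for i
  proof -
    have "?L i = (\<Sum>i'<?n. \<Sum>s=1..r. \<Sum>s'=1..r.
        C j (I!i) s (C k (I[i:=s]!i') s' (F (I[i:=s, i':=s']))))"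
      unfolding C_simps by (rule sum.swap)
    also have "\<dots> = (\<Sum>i'\<in>{..<?n} - {i}. \<Sum>s=1..r. \<Sum>s'=1..r.
        C j (I!i) s (C k (I[i:=s]!i') s' (F (I[i:=s, i':=s']))))
        + (\<Sum>s=1..r. \<Sum>l=1..r. C j (I!i) s (C k s l (F (I[i:=l]))))"
      (is "_ = ?Q' + ?R'")
    proof -
      \<comment> \<open>In the summand with equal slots the second bracket acts on the entry
        \<open>s\<close> just inserted and overwrites it.\<close>
      have "i \<in> {..<?n}" using that by simp
      from sum.remove[OF _ this, of "\<lambda>i'. \<Sum>s=1..r. \<Sum>s'=1..r.
        C j (I!i) s (C k (I[i:=s]!i') s' (F (I[i:=s, i':=s'])))"] that
      show ?thesis by (simp add: add.commute)
    qed
    also have "(\<Sum>s=1..r. \<Sum>l=1..r. C j (I!i) s (C k s l (F (I[i:=l])))) = ?R i"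
      by (rule sum.swap)
    also have "(\<Sum>i'\<in>{..<?n} - {i}. \<Sum>s=1..r. \<Sum>s'=1..r.
        C j (I!i) s (C k (I[i:=s]!i') s' (F (I[i:=s, i':=s'])))) = ?Q i"
      by (intro sum.cong refl) auto
    finally show ?thesis .
  qed
  then have *: "(\<Sum>i<?n. ?L i) = (\<Sum>i<?n. ?Q i) + (\<Sum>i<?n. ?R i)"
    by (simp add: sum.distrib)
  have "Lie j (Lie k F) I = P j (P k (F I))
     - (\<Sum>i<?n. \<Sum>s=1..r. P j (C k (I!i) s (F (I[i:=s]))))
     - (\<Sum>i<?n. \<Sum>s=1..r. C j (I!i) s (P k (F (I[i:=s])))) + (\<Sum>i<?n. ?L i)"
    unfolding Lie_def by (simp add: P_simps C_simps(1) sum_subtractf)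
  then show ?thesis unfolding * Leibniz[OF F] by simp
qed

text \<open>The terms with two slots and those mixing \<open>P\<close> with \<open>C\<close> cancel
  by symmetry. Jacobi turns the one-slot terms into brackets with
  \<open>[e\<^sub>j, e\<^sub>k]\<close> plus derivatives of c, of which only
  \<open>E (I ! i) j k\<close> survives against those coming from \<open>Leibniz\<close>. For
  alternating \<open>F\<close> the last sum is the wedge correction, by
  \<open>d_wedge_alternating\<close>.\<close>

lemma Lie_commutator:
  assumes F: "\<And>K. F K \<in> V"
  shows "Lie j (Lie k F) I - Lie k (Lie j F) I
    = (\<Sum>s=1..r. C j k s (Lie s F I)) + (\<Sum>s=1..r. \<Sum>i<length I. E (I!i) j k s (F (I[i:=s])))"
proof -
  let ?n = "length I"
  define Q where "Q j k = (\<Sum>i<?n. \<Sum>i'\<in>{..<?n} - {i}. \<Sum>s=1..r. \<Sum>s'=1..r.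
         C j (I!i) s (C k (I!i') s' (F (I[i:=s, i':=s']))))" for j k
  \<comment> \<open>The two slots are exchanged together with their summation indices; the operators
    \<open>C\<close> commute, and so do updates of distinct slots.\<close>
  have Q_sym: "Q j k = Q k j"
  proof -
    let ?t = "\<lambda>i i' s s'. C k (I!i) s (C j (I!i') s' (F (I[i:=s, i':=s'])))"
    have swp: "(\<Sum>i<?n. \<Sum>i'\<in>{..<?n} - {i}. g i i') = (\<Sum>i<?n. \<Sum>i'\<in>{..<?n} - {i}. g i' i)"
      for g :: "nat \<Rightarrow> nat \<Rightarrow> 'v"
    proof -
      have "(\<Sum>i<?n. \<Sum>i'\<in>{..<?n} - {i}. g i i')
        = (\<Sum>i<?n. \<Sum>i'\<in>{i'\<in>{..<?n}. i \<noteq> i'}. g i i')"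
        by (intro sum.cong refl) auto
      also have "\<dots> = (\<Sum>i'<?n. \<Sum>i\<in>{i\<in>{..<?n}. i \<noteq> i'}. g i i')"
        by (rule sum.swap_restrict) auto
      also have "\<dots> = (\<Sum>i<?n. \<Sum>i'\<in>{..<?n} - {i}. g i' i)"
        by (intro sum.cong refl) auto
      finally show ?thesis .
    qed
    have "Q j k = (\<Sum>i<?n. \<Sum>i'\<in>{..<?n} - {i}. \<Sum>s=1..r. \<Sum>s'=1..r.
         C j (I!i') s (C k (I!i) s' (F (I[i':=s, i:=s']))))"
      unfolding Q_def by (rule swp)
    also have "\<dots> = Q k j"
      unfolding Q_def
    proof (rule sum.cong[OF refl], rule sum.cong[OF refl])
      fix i i' assume "i \<in> {..<?n}" "i' \<in> {..<?n} - {i}"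
      then have "C j (I!i') s (C k (I!i) s' (F (I[i':=s, i:=s']))) = ?t i i' s' s" for s s'
        by (subst C_commute) (simp add: list_update_swap)
      then show "(\<Sum>s=1..r. \<Sum>s'=1..r. C j (I!i') s (C k (I!i) s' (F (I[i':=s, i:=s']))))
        = (\<Sum>s=1..r. \<Sum>s'=1..r. ?t i i' s s')"
        by (subst sum.swap) simp
    qed
    finally show ?thesis .
  qed
  have jac: "(\<Sum>s=1..r. C j m s (C k s l v)) - (\<Sum>s=1..r. C k m s (C j s l v))
      = E m j k l v + E j k m l v - E k j m l v - (\<Sum>s=1..r. C j k s (C s m l v))"
    if "v \<in> V" for m l v
    using Jacobi[OF that, of j k m l] by (simp add: algebra_simps)
  have "Lie j (Lie k F) I - Lie k (Lie j F) I
    = (P j (P k (F I)) - P k (P j (F I)))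
      + (\<Sum>i<?n. \<Sum>l=1..r. E k j (I!i) l (F (I[i:=l])) - E j k (I!i) l (F (I[i:=l]))
          + ((\<Sum>s=1..r. C j (I!i) s (C k s l (F (I[i:=l]))))
             - (\<Sum>s=1..r. C k (I!i) s (C j s l (F (I[i:=l]))))))"
    unfolding Lie_Lie[OF F] Q_def[symmetric] Q_sym
    by (simp add: sum.distrib sum_subtractf)
  also have "\<dots> = (\<Sum>s=1..r. C j k s (P s (F I)))
      + (\<Sum>i<?n. \<Sum>l=1..r. E (I!i) j k l (F (I[i:=l]))
          - (\<Sum>s=1..r. C j k s (C s (I!i) l (F (I[i:=l])))))"
    unfolding P_commutator[OF F] jac[OF F] by (simp add: algebra_simps)
  also have "\<dots> = (\<Sum>s=1..r. C j k s (P s (F I)))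
      - (\<Sum>s=1..r. \<Sum>i<?n. \<Sum>l=1..r. C j k s (C s (I!i) l (F (I[i:=l]))))
      + (\<Sum>i<?n. \<Sum>l=1..r. E (I!i) j k l (F (I[i:=l])))"
  proof -
    have "(\<Sum>i<?n. \<Sum>l=1..r. \<Sum>s=1..r. C j k s (C s (I!i) l (F (I[i:=l]))))
      = (\<Sum>s=1..r. \<Sum>i<?n. \<Sum>l=1..r. C j k s (C s (I!i) l (F (I[i:=l]))))"
      by (subst sum.swap[of _ "{1..r}" "{1..r}"], rule sum.swap)
    then show ?thesis by (simp add: sum_subtractf)
  qed
  also have "(\<Sum>i<?n. \<Sum>l=1..r. E (I!i) j k l (F (I[i:=l])))
    = (\<Sum>s=1..r. \<Sum>i<?n. E (I!i) j k s (F (I[i:=s])))"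
    by (rule sum.swap)
  finally show ?thesis by (simp add: Lie_def C_simps sum_subtractf)
qed

text \<open>After contraction with \<open>e\<^sub>k\<close>, both sides expand by
  \<open>Lie_Cons\<close> and Cartan's formula. Apart from terms settled by induction, the
  difference is the commutator of \<open>L\<^sub>j\<close> and \<open>L\<^sub>k\<close>, whose wedge
  terms are those that \<open>D_C\<close> creates on the right.\<close>

lemma Lie_D_commute:
  assumes "alternating F" "\<And>K. F K \<in> V"
  shows "Lie j (\<lambda>K. D K F) I = D I (Lie j F)"
  using assms
proof (induction I arbitrary: F)
  case Nil
  show ?case by (simp add: Lie_def P_simps)
next
  case (Cons k I)
  have alt: "alternating (\<lambda>K. F (x # K))" for x
    using Cons.prems(1) by (rule alternating_Cons)
  have IH: "Lie j (\<lambda>K. D K (\<lambda>K. F (k # K))) I = D I (Lie j (\<lambda>K. F (k # K)))"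
    by (rule Cons.IH[OF alt]) (rule Cons.prems)
  have "Lie j (\<lambda>K. D K F) (k # I)
      = Lie j (Lie k F) I - D I (Lie j (\<lambda>K. F (k # K)))
        - (\<Sum>s=1..r. C j k s (Lie s F I)) + (\<Sum>s=1..r. C j k s (D I (\<lambda>K. F (s # K))))"
    unfolding Lie_Cons[of j _ k I] D.simps Lie_diff IH
    by (simp add: C_simps sum_subtractf)
  moreover have "D (k # I) (Lie j F)
      = Lie k (Lie j F) I - D I (Lie j (\<lambda>K. F (k # K)))
        + (\<Sum>s=1..r. C j k s (D I (\<lambda>K. F (s # K)))
            + (\<Sum>i<length I. E (I!i) j k s (F (I[i:=s]))))"
    unfolding D.simps Lie_Cons D_diff D_sum
    by (simp add: D_C[OF Cons.prems(2)] d_wedge_alternating[OF Cons.prems(1)])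
  ultimately show ?case
    using Lie_commutator[OF Cons.prems(2), where j=j and k=k and I=I]
    by (simp add: sum.distrib algebra_simps)
qed

text \<open>Cartan's formula used twice gives
  \<open>\<iota>\<^sub>j d d = [L\<^sub>j, d] + d d \<iota>\<^sub>j\<close>; the first term
  vanishes, and the second is the induction hypothesis for the contraction.\<close>

lemma D_D:
  assumes "alternating F" "\<And>K. F K \<in> V"
  shows "D I (\<lambda>K. D K F) = 0"
  using assms
proof (induction I arbitrary: F)
  case (Cons j I)
  have "D I (\<lambda>K. D K (\<lambda>K. F (j # K))) = 0"
    by (intro Cons.IH alternating_Cons Cons.prems)
  then show ?case
    using Lie_D_commute[OF Cons.prems, of j I] by (simp add: D_diff)
qed simp

text \<open>Once the prefix is peeled off, the swap exchanges the brackets acting in slot 0 with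
  those acting in slot 1.\<close>

lemma alternating_Lie:
  assumes F: "alternating F"
  shows "alternating (Lie j F)"
  unfolding alternating_def
proof (intro allI)
  fix A x y B
  show "Lie j F (A @ x # y # B) = - Lie j F (A @ y # x # B)"
    using F
  proof (induction A arbitrary: F)
    case Nil
    have "(\<lambda>K. F (x # y # K)) = (\<lambda>K. - F (y # x # K))"
      using alternating_swap0[OF Nil] by blast
    moreover have "Lie j (\<lambda>K. - G K) B = - Lie j G B" for G
      by (simp add: Lie_def P_simps C_simps sum_negf)
    moreover have "(\<Sum>s=1..r. C j x s (F (s # y # B))) = - (\<Sum>s=1..r. C j x s (F (y # s # B)))"
      by (simp only: sum_negf[symmetric] C_simps(3)[symmetric] alternating_swap0[OF Nil, of _ y B])
    moreover have "(\<Sum>s=1..r. C j y s (F (x # s # B))) = - (\<Sum>s=1..r. C j y s (F (s # x # B)))"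
      by (simp only: sum_negf[symmetric] C_simps(3)[symmetric] alternating_swap0[OF Nil, of x _ B])
    ultimately show ?case
      by (simp add: Lie_Cons)
  next
    case (Cons a A)
    have "(\<Sum>s=1..r. C j a s (F (s # A @ x # y # B)))
      = (\<Sum>s=1..r. C j a s (- F (s # A @ y # x # B)))"
      using alternating_swap[OF Cons.prems, of "_ # A" x y B] by (simp only: append_Cons)
    then show ?case
      using Cons.IH[OF alternating_Cons[OF Cons.prems, of a]]
      by (simp add: Lie_Cons C_simps sum_negf)
  qed
qed

text \<open>Needed to recognise \<open>D\<close> as the antisymmetric extension built into
  \<open>complex_op\<close>, and to apply the explicit formula to \<open>D\<close> itself. At the
  front of the list, two uses of Cartan's formula leave the contraction by
  \<open>[e\<^sub>x, e\<^sub>y]\<close>, which \<open>C_antisym\<close> handles.\<close>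

lemma alternating_D:
  assumes "alternating F" "\<And>K. F K \<in> V"
  shows "alternating (\<lambda>K. D K F)"
  unfolding alternating_def
proof (intro allI)
  fix A x y B
  show "D (A @ x # y # B) F = - D (A @ y # x # B) F"
    using assms
  proof (induction A arbitrary: F)
    case Nil
    have "(\<lambda>K. F (x # y # K)) = (\<lambda>K. - F (y # x # K))"
      using alternating_swap0[OF Nil(1)] by blast
    moreover have "(\<Sum>s=1..r. C x y s (F (s # B))) = - (\<Sum>s=1..r. C y x s (F (s # B)))"
      using C_antisym[OF Nil(2), of x y] by (simp add: sum_negf)
    ultimately show ?case
      by (simp add: Lie_Cons D_minus)
  next
    case (Cons a A)
    have "D (A @ x # y # B) (\<lambda>K. F (a # K)) = - D (A @ y # x # B) (\<lambda>K. F (a # K))"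
      by (intro Cons.IH alternating_Cons Cons.prems)
    then show ?case
      using alternating_swap[OF alternating_Lie[OF Cons.prems(1)], of a A x y B] by simp
  qed
qed

end

section \<open>Strictly increasing multi-indices\<close>

text \<open>On distinct lists this is the parity of the number of inversions. Unlike the definite
  description in \<open>sgn_perm\<close>, it decomposes along the head of the list and so suits
  induction.\<close>

primrec inversion_sign :: "nat list \<Rightarrow> int" where
  "inversion_sign [] = 1"
| "inversion_sign (x # xs) = (-1) ^ card {y \<in> set xs. y < x} * inversion_sign xs"

lemma inversion_sign_swap_aux:
  assumes "x \<notin> set B" "x < y"
  shows "inversion_sign (x # y # B) = - inversion_sign (y # x # B)"
proof -
  have "{z \<in> set (y # B). z < x} = {z \<in> set B. z < x}"
    "{z \<in> set (x # B). z < y} = insert x {z \<in> set B. z < y}"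
    using assms by auto
  with assms(1) show ?thesis by (simp del: set_simps)
qed

lemma inversion_sign_swap:
  assumes "distinct (A @ x # y # B)"
  shows "inversion_sign (A @ x # y # B) = - inversion_sign (A @ y # x # B)"
  using assms
proof (induction A)
  case Nil
  then consider "x < y" | "y < x" by fastforce
  then show ?case
    using inversion_sign_swap_aux[of x B y] inversion_sign_swap_aux[of y B x] Nil
    by cases simp_all
next
  case (Cons a A)
  then show ?case by (simp add: insert_commute)
qed

lemma inversion_sign_sorted: "sorted J \<Longrightarrow> inversion_sign J = 1"
proof (induction J)
  case (Cons x xs)
  then have "{y \<in> set xs. y < x} = {}" by auto
  with Cons show ?case by (simp del: Collect_empty_eq)
qed simp

text \<open>Insertion sort undone: every insertion is a chain of adjacent swaps. The prefix
  \<open>A\<close> is generalised because the swaps take place behind entries already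
  passed.\<close>

lemma adjacent_swap_induct:
  assumes "P (sort K)" and swap: "\<And>A x y B. P (A @ x # y # B) \<Longrightarrow> P (A @ y # x # B)"
  shows "P K"
proof -
  have insort: "P (A @ x # L)" if "P (A @ insort x L)" for A x and L :: "'a list"
    using that
  proof (induction L arbitrary: A)
    case (Cons y L)
    then show ?case
      using Cons.IH[of "A @ [y]"] swap[of A y x L] by (auto split: if_splits)
  qed simp
  have "P (A @ K)" if "P (A @ sort K)" for A
    using that
  proof (induction K arbitrary: A)
    case (Cons x K)
    then have "P ((A @ [x]) @ sort K)" using insort[of A x "sort K"] by simp
    then show ?case using Cons.IH[of "A @ [x]"] by simp
  qed simp
  from this[of "[]"] assms(1) show ?thesis by simp
qed

lemma permute_list_transpose:
  assumes "Suc i < length xs"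
  shows "permute_list (Transposition.transpose i (Suc i)) xs = xs[i := xs ! Suc i, Suc i := xs ! i]"
  using assms by (intro nth_equalityI) (auto simp: permute_list_def Transposition.transpose_def nth_list_update)

lemma list_swap_append:
  "(A @ x # y # B)[length A := y, Suc (length A) := x] = A @ y # x # B"
  by (simp add: list_update_append)

lemma permute_list_swap:
  "permute_list (Transposition.transpose (length A) (Suc (length A))) (A @ x # y # B) = A @ y # x # B"
  using list_swap_append[of A x y B] by (subst permute_list_transpose) (simp_all add: nth_append)

lemma permute_list_inj:
  assumes "distinct J" "p permutes {..<length J}" "q permutes {..<length J}"
    and "permute_list p J = permute_list q J"
  shows "p = q"
proof
  fix i
  show "p i = q i"
  proof (cases "i < length J")
    case True
    then have "J ! p i = J ! q i"
      using permute_list_nth[OF assms(2)] permute_list_nth[OF assms(3)] assms(4) by metis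
    moreover have "p i < length J" "q i < length J"
      using True permutes_in_image[OF assms(2)] permutes_in_image[OF assms(3)] by auto
    ultimately show ?thesis using assms(1) nth_eq_iff_index_eq by blast
  next
    case False
    then show ?thesis using assms(2,3) by (simp add: permutes_def)
  qed
qed

text \<open>A permutation producing the list is carried along the adjacent swaps: each swap composes
  it with a transposition, which flips its sign together with the inversion sign. Distinctness makes
  the permutation unique, so the definite description picks it.\<close>

lemma sgn_perm_eq_inversion_sign:
  assumes "sorted J" "distinct J" "distinct K" "set K = set J"
  shows "sgn_perm J K = inversion_sign K"
proof -
  let ?Q = "\<lambda>L. distinct L \<and> (\<exists>p. p permutes {..<length J} \<and> permute_list p J = L \<and>
    sign p = inversion_sign L)"
  have "sort K = J"
    by (rule sorted_distinct_set_unique) (use assms in auto)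
  moreover have "?Q J"
    using assms(1,2) by (auto simp: inversion_sign_sorted intro!: exI[of _ id] permutes_id)
  ultimately have "?Q (sort K)" by simp
  then have "?Q K"
  proof (rule adjacent_swap_induct)
    fix A x y B
    assume "?Q (A @ x # y # B)"
    then obtain p where p: "p permutes {..<length J}" "permute_list p J = A @ x # y # B"
      "sign p = inversion_sign (A @ x # y # B)" and d: "distinct (A @ x # y # B)" by blast
    let ?t = "Transposition.transpose (length A) (Suc (length A))"
    have len: "length J = length (A @ x # y # B)" using p(2) by (metis length_permute_list)
    have t: "?t permutes {..<length J}"
      by (rule permutes_swap_id) (auto simp: len)
    have "p \<circ> ?t permutes {..<length J}" using permutes_compose[OF t p(1)] .
    moreover have "permute_list (p \<circ> ?t) J = A @ y # x # B"
      using permute_list_compose[OF t] p(2) permute_list_swap by metis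
    moreover have "sign (p \<circ> ?t) = - sign p"
      using permutes_imp_permutation[OF _ p(1)] by (simp add: sign_compose sign_swap_id permutation_swap_id)
    ultimately show "?Q (A @ y # x # B)"
      using p(3) inversion_sign_swap[OF d] d by (intro conjI exI[of _ "p \<circ> ?t"]) auto
  qed
  then obtain p where p: "p permutes {..<length J}" "permute_list p J = K"
    "sign p = inversion_sign K" by blast
  then have "(THE p. p permutes {..<length J} \<and> permute_list p J = K) = p"
    using permute_list_inj[OF assms(2)] by blast
  then show ?thesis using p(3) by (simp add: sgn_perm_def)
qed

lemma alternating_sort:
  fixes H :: "nat list \<Rightarrow> complex"
  assumes H: "alternating H" and L: "distinct L"
  shows "H L = of_int (inversion_sign L) * H (sort L)"
proof -
  let ?Q = "\<lambda>K. distinct K \<and> H K = of_int (inversion_sign K) * H (sort L)"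
  have "?Q L"
  proof (rule adjacent_swap_induct[of ?Q])
    fix A x y B
    assume "?Q (A @ x # y # B)"
    then show "?Q (A @ y # x # B)"
      using alternating_swap[OF H, of A y x B] inversion_sign_swap[of A x y B] by auto
  qed (use L in \<open>simp add: inversion_sign_sorted\<close>)
  then show ?thesis by simp
qed

text \<open>After sorting, a repeated entry has an equal neighbour, so the value is its own
  negative, hence 0 in the complex numbers; vanishing is then preserved by adjacent swaps.\<close>

lemma alternating_not_distinct:
  fixes H :: "nat list \<Rightarrow> complex"
  assumes H: "alternating H" and L: "\<not> distinct L"
  shows "H L = 0"
proof (rule adjacent_swap_induct)
  have "\<not> distinct (sort L)" using L by simp
  then obtain i where i: "Suc i < length (sort L)" "sort L ! i = sort L ! Suc i"
    by (metis sorted_sort sorted_wrt_iff_nth_Suc_transp strict_sorted_iff linorder_not_le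
        order_le_imp_less_or_eq sorted_iff_nth_Suc transp_on_less)
  have "sort L = take i (sort L) @ sort L ! i # sort L ! Suc i # drop (Suc (Suc i)) (sort L)"
    using i(1) by (metis Cons_nth_drop_Suc Suc_lessD append_take_drop_id)
  then obtain A x B where "sort L = A @ x # x # B" using i(2) by metis
  moreover have "H (A @ x # x # B) = 0"
    using alternating_swap[OF H, of A x x B] by simp
  ultimately show "H (sort L) = 0" by simp
next
  fix A x y B assume "H (A @ x # y # B) = 0"
  then show "H (A @ y # x # B) = 0" using alternating_swap[OF H, of A y x B] by simp
qed

lemma alternating_move:
  fixes H :: "nat list \<Rightarrow> complex"
  assumes "alternating H"
  shows "H (A @ s # B) = (-1) ^ length A * H (s # A @ B)"
  using assms
proof (induction A arbitrary: H)
  case (Cons a A)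
  have "H (a # A @ s # B) = (-1) ^ length A * H (a # s # A @ B)"
    using Cons.IH[OF alternating_Cons[OF Cons.prems]] .
  also have "H (a # s # A @ B) = - H (s # a # A @ B)"
    using alternating_swap0[OF Cons.prems] .
  finally show ?case by simp
qed simp

text \<open>The shape of \<open>complex_op_incr\<close> with its operators abstracted into
  \<open>a\<close> and \<open>b\<close>, so that an induction on \<open>J\<close> can absorb a
  peeled index into them.\<close>

definition increasing_sum ::
    "(nat \<Rightarrow> nat list \<Rightarrow> complex) \<Rightarrow> (nat \<Rightarrow> nat \<Rightarrow> nat list \<Rightarrow> complex) \<Rightarrow> nat list \<Rightarrow> complex" where
  "increasing_sum a b J =
     (\<Sum>j\<in>set J. (-1) ^ card {i \<in> set J - {j}. i < j} * a j (list_minus J {j}))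
     - (\<Sum>(m, n) \<in> {(m, n). m \<in> set J \<and> n \<in> set J \<and> m < n}.
          of_int (inversion_sign (m # n # list_minus J {m, n})) * b m n (list_minus J {m, n}))"

lemma list_minus_id: "set J \<inter> A = {} \<Longrightarrow> list_minus J A = J"
  by (auto simp: list_minus_def intro!: filter_True)

lemma set_list_minus [simp]: "set (list_minus J A) = set J - A"
  by (auto simp: list_minus_def)

text \<open>As \<open>j\<close> is the least entry, removing it costs no sign, while keeping it adds
  one inversion in the first sum and two in the second. The minus sign before \<open>b\<close>
  therefore undoes the outer one; in the application it comes from exchanging \<open>s\<close> and
  \<open>j\<close>.\<close>

lemma increasing_sum_Cons:
  assumes "sorted (j # I)" "distinct (j # I)"
  shows "increasing_sum a b (j # I) = a j I
    - (\<Sum>n\<in>set I. of_int (inversion_sign (n # list_minus I {n})) * b j n (list_minus I {n}))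
    - increasing_sum (\<lambda>i K. a i (j # K)) (\<lambda>m n K. - b m n (j # K)) I"
proof -
  have jI: "j < i" if "i \<in> set I" for i
    using assms that by (auto simp: order.strict_iff_order)
  then have j: "j \<notin> set I" by blast
  let ?pairs = "\<lambda>A. {(m, n). m \<in> A \<and> n \<in> A \<and> m < n}"
  have pairs: "?pairs (set (j # I)) = Pair j ` set I \<union> ?pairs (set I)"
    using jI by (auto dest: order.asym)
  have fin: "finite (?pairs (set I))"
    by (rule finite_subset[of _ "set I \<times> set I"]) auto
  let ?t = "\<lambda>J (m, n). of_int (inversion_sign (m # n # list_minus J {m, n}))
    * b m n (list_minus J {m, n}) :: complex"
  have "sum (?t (j # I)) (?pairs (set (j # I)))
    = sum (?t (j # I)) (Pair j ` set I) + sum (?t (j # I)) (?pairs (set I))"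
    unfolding pairs by (rule sum.union_disjoint) (use fin j in auto)
  also have "sum (?t (j # I)) (Pair j ` set I)
    = (\<Sum>n\<in>set I. of_int (inversion_sign (n # list_minus I {n})) * b j n (list_minus I {n}))"
  proof (subst sum.reindex)
    have "inversion_sign (j # n # list_minus I {n}) = inversion_sign (n # list_minus I {n})"
      if "n \<in> set I" for n
    proof -
      have "{y \<in> set (n # list_minus I {n}). y < j} = {}"
        using that jI[of n] by (auto dest: jI order.asym)
      then show ?thesis by (simp del: Collect_empty_eq set_list_minus set_simps)
    qed
    moreover have "list_minus (j # I) {j, n} = list_minus I {n}" for n
      using j by (auto simp: list_minus_def intro!: filter_cong)
    ultimately show "sum (?t (j # I) \<circ> Pair j) (set I) =
      (\<Sum>n\<in>set I. of_int (inversion_sign (n # list_minus I {n})) * b j n (list_minus I {n}))"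
      by (intro sum.cong refl) (simp del: inversion_sign.simps)
  qed (auto intro: inj_onI)
  also have "sum (?t (j # I)) (?pairs (set I)) =
    (\<Sum>(m, n) \<in> ?pairs (set I). of_int (inversion_sign (m # n # list_minus I {m, n})) *
        b m n (j # list_minus I {m, n}))"
  proof (intro sum.cong refl, clarify)
    fix m n assume mn: "m \<in> set I" "n \<in> set I" "m < n"
    let ?R = "list_minus I {m, n}"
    have "list_minus (j # I) {m, n} = j # ?R"
      using jI[OF mn(1)] jI[OF mn(2)] by (simp add: list_minus_def)
    moreover have "{y \<in> set (n # j # ?R). y < m} = insert j {y \<in> set (n # ?R). y < m}"
      "{y \<in> set (j # ?R). y < n} = insert j {y \<in> set ?R. y < n}" "{y \<in> set ?R. y < j} = {}"
      using jI[OF mn(1)] jI[OF mn(2)] by (auto dest: jI)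
    moreover have "j \<notin> {y \<in> set (n # ?R). y < m}" "j \<notin> {y \<in> set ?R. y < n}"
      using j jI[OF mn(2)] by auto
    ultimately have "inversion_sign (m # n # list_minus (j # I) {m, n})
      = inversion_sign (m # n # ?R)"
      by (simp del: set_simps set_list_minus Collect_empty_eq)
    with \<open>list_minus (j # I) {m, n} = j # ?R\<close>
    show "of_int (inversion_sign (m # n # list_minus (j # I) {m, n}))
      * b m n (list_minus (j # I) {m, n}) = of_int (inversion_sign (m # n # ?R)) * b m n (j # ?R)"
      by (simp only:)
  qed
  finally have 2: "sum (?t (j # I)) (?pairs (set (j # I)))
    = (\<Sum>n\<in>set I. of_int (inversion_sign (n # list_minus I {n})) * b j n (list_minus I {n}))
      + (\<Sum>(m, n) \<in> ?pairs (set I). of_int (inversion_sign (m # n # list_minus I {m, n})) *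
          b m n (j # list_minus I {m, n}))" .
  have "(\<Sum>i\<in>set (j # I). (-1) ^ card {k \<in> set (j # I) - {i}. k < i} * a i (list_minus (j # I) {i}))
    = a j I + (\<Sum>i\<in>set I. (-1) ^ card {k \<in> set (j # I) - {i}. k < i} * a i (list_minus (j # I) {i}))"
  proof -
    have "{k \<in> set (j # I) - {j}. k < j} = {}" by (auto dest: jI order.asym)
    moreover have "list_minus (j # I) {j} = I"
      using list_minus_id[of I "{j}"] j by (simp add: list_minus_def)
    moreover have "sum g (set (j # I)) = g j + sum g (set I)" for g :: "nat \<Rightarrow> complex"
      using j by simp
    ultimately show ?thesis by (simp only: card.empty power_0 mult_1)
  qed
  also have "(\<Sum>i\<in>set I. (-1) ^ card {k \<in> set (j # I) - {i}. k < i} * a i (list_minus (j # I) {i}))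
    = - (\<Sum>i\<in>set I. (-1) ^ card {k \<in> set I - {i}. k < i} * a i (j # list_minus I {i}))"
    unfolding sum_negf[symmetric]
  proof (intro sum.cong refl)
    fix i assume i: "i \<in> set I"
    then have "{k \<in> set (j # I) - {i}. k < i} = insert j {k \<in> set I - {i}. k < i}"
      "j \<notin> {k \<in> set I - {i}. k < i}" "list_minus (j # I) {i} = j # list_minus I {i}"
      using j jI[OF i] by (auto simp: list_minus_def)
    then show "(-1) ^ card {k \<in> set (j # I) - {i}. k < i} * a i (list_minus (j # I) {i})
      = - ((-1) ^ card {k \<in> set I - {i}. k < i} * a i (j # list_minus I {i}))"
      by (simp del: set_simps)
  qed
  finally show ?thesis
    unfolding increasing_sum_def 2 by (simp add: sum_negf case_prod_beta)
qed

text \<open>\<open>e\<close> will be evaluation at a test function: the scalar signs of the explicit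
  formula make sense only after mapping the abelian group into the complex numbers.\<close>

lemma (in lie_algebroid_rep) D_increasing:
  fixes e :: "'v \<Rightarrow> complex"
  assumes e: "Modules.additive e" and "alternating F" "sorted J" "distinct J"
  shows "e (D J F) = increasing_sum (\<lambda>j K. e (P j (F K)))
    (\<lambda>m n K. \<Sum>s=1..r. e (C m n s (F (s # K)))) J"
  using assms(2-)
proof (induction J arbitrary: F)
  case Nil
  show ?case by (simp add: increasing_sum_def Modules.additive.zero[OF e])
next
  case (Cons j I)
  note e_simps = Modules.additive.zero[OF e] Modules.additive.diff[OF e] Modules.additive.sum[OF e]
    Modules.additive.minus[OF e]
  have I: "sorted I" "distinct I" using Cons.prems by auto
  have IH: "e (D I (\<lambda>K. F (j # K))) = increasing_sum (\<lambda>i K. e (P i (F (j # K))))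
      (\<lambda>m n K. \<Sum>s=1..r. e (C m n s (F (j # s # K)))) I"
    using Cons by (intro Cons.IH alternating_Cons) auto
  \<comment> \<open>This exchange supplies the minus sign demanded by
    \<open>increasing_sum_Cons\<close>.\<close>
  have neg: "(\<Sum>s=1..r. e (C m n s (F (j # s # K)))) = - (\<Sum>s=1..r. e (C m n s (F (s # j # K))))"
    for m n K
    unfolding sum_negf[symmetric] e_simps(4)[symmetric] C_simps(3)[symmetric]
    by (simp only: alternating_swap0[OF Cons.prems(1), of j])
  have "e (Lie j F I) = e (P j (F I))
      - (\<Sum>k<length I. \<Sum>s=1..r. e (C j (I ! k) s (F (I[k := s]))))"
    by (simp add: Lie_def e_simps)
  also have "(\<Sum>k<length I. \<Sum>s=1..r. e (C j (I ! k) s (F (I[k := s]))))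
    = (\<Sum>k<length I. of_int (inversion_sign (I ! k # list_minus I {I ! k})) *
        (\<Sum>s=1..r. e (C j (I ! k) s (F (s # list_minus I {I ! k})))))"
    unfolding sum_distrib_left
  proof (intro sum.cong refl)
    fix k s assume "k \<in> {..<length I}"
    then have k: "k < length I" by simp
    define A B n where "A = take k I" and "B = drop (Suc k) I" and "n = I ! k"
    have I_eq: "I = A @ n # B" and up: "I[k := s] = A @ s # B"
      using k by (simp_all add: A_def B_def n_def id_take_nth_drop upd_conv_take_nth_drop)
    have minus: "list_minus I {n} = A @ B"
      using I(2) by (auto simp: I_eq list_minus_def intro!: arg_cong2[where f = "(@)"] filter_True)
    \<comment> \<open>By sortedness the entries below \<open>n\<close> are those in front of it, so
      extracting \<open>n\<close> to the front costs the same sign as moving \<open>s\<close>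
      there.\<close>
    have "{y \<in> set (A @ B). y < n} = set A"
      using I by (auto simp: I_eq sorted_append order.strict_iff_order)
    moreover have "distinct A" "sorted (A @ B)" using I by (auto simp: I_eq sorted_append)
    ultimately have "inversion_sign (n # A @ B) = (-1) ^ length A"
      by (simp add: inversion_sign_sorted distinct_card del: set_append)
    moreover have "alternating (\<lambda>K. e (C j n s (F K)))"
      using Cons.prems(1) unfolding alternating_def
      by (metis C_simps(3) e_simps(4))
    ultimately show "e (C j (I ! k) s (F (I[k := s])))
      = of_int (inversion_sign (I ! k # list_minus I {I ! k})) *
        e (C j (I ! k) s (F (s # list_minus I {I ! k})))"
      unfolding n_def[symmetric] up minus
      using alternating_move[of "\<lambda>K. e (C j n s (F K))" A s B] by simp
  qed
  also have "\<dots> = (\<Sum>n\<in>set I. of_int (inversion_sign (n # list_minus I {n})) *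
        (\<Sum>s=1..r. e (C j n s (F (s # list_minus I {n})))))"
    by (rule sum.reindex_bij_betw) (use bij_betw_nth[OF I(2)] in auto)
  finally show ?case
    by (subst increasing_sum_Cons) (use Cons.prems in \<open>simp_all add: e_simps IH[unfolded neg]\<close>)
qed

section \<open>Smooth functions and test functions\<close>

lemma has_vector_derivative_line:
  fixes u :: "real^'n \<Rightarrow> complex"
  assumes "u differentiable (at (y + t *\<^sub>R axis \<nu> 1))"
  shows "((\<lambda>t. u (y + t *\<^sub>R axis \<nu> 1)) has_vector_derivative partial \<nu> u (y + t *\<^sub>R axis \<nu> 1)) (at t)"
proof -
  obtain u' where u': "(u has_derivative u') (at (y + t *\<^sub>R axis \<nu> 1))"
    using assms by (auto simp: differentiable_def)
  \<comment> \<open>\<open>partial\<close> differentiates at parameter 0 with the point itself as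
    base. Allowing every base and parameter that hit the point covers this case and the given line
    at once.\<close>
  have gen: "((\<lambda>s. u (z + s *\<^sub>R axis \<nu> 1)) has_vector_derivative u' (axis \<nu> 1)) (at s)"
    if "z + s *\<^sub>R axis \<nu> 1 = y + t *\<^sub>R axis \<nu> 1" for z s
  proof -
    have "((\<lambda>s. z + s *\<^sub>R axis \<nu> 1) has_derivative (\<lambda>s. s *\<^sub>R axis \<nu> 1)) (at s)"
      by (auto intro!: derivative_eq_intros)
    moreover have "(u has_derivative u') (at (z + s *\<^sub>R axis \<nu> 1))"
      using u' that by simp
    ultimately have "((\<lambda>s. u (z + s *\<^sub>R axis \<nu> 1)) has_derivative (\<lambda>s. u' (s *\<^sub>R axis \<nu> 1))) (at s)"
      by (rule has_derivative_compose)
    then show ?thesis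
      unfolding has_vector_derivative_def
      by (simp add: linear_scale[OF bounded_linear.linear[OF has_derivative_bounded_linear[OF u']]])
  qed
  from gen[of "y + t *\<^sub>R axis \<nu> 1" 0] have "partial \<nu> u (y + t *\<^sub>R axis \<nu> 1) = u' (axis \<nu> 1)"
    unfolding partial_def by (intro vector_derivative_at) simp
  with gen[of y t] show ?thesis by simp
qed

lemma has_vector_derivative_partial:
  fixes u :: "real^'n \<Rightarrow> complex"
  assumes "u differentiable (at x)"
  shows "((\<lambda>t. u (x + t *\<^sub>R axis \<nu> 1)) has_vector_derivative partial \<nu> u x) (at 0)"
  using has_vector_derivative_line[of u x 0 \<nu>] assms by simp

lemma partialI:
  "((\<lambda>t. u (x + t *\<^sub>R axis \<nu> 1)) has_vector_derivative d) (at 0) \<Longrightarrow> partial \<nu> u x = d"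
  unfolding partial_def by (rule vector_derivative_at)

lemma partial_const [simp]: "partial \<nu> (\<lambda>x. k) = (\<lambda>x. 0)"
  by (rule ext, rule partialI) auto

lemma partial_coord: "partial \<nu> (\<lambda>x. of_real (x $ \<mu>)) = (\<lambda>x. if \<nu> = \<mu> then 1 else 0)"
proof (rule ext, rule partialI)
  fix x :: "real^'a"
  have "(\<lambda>t. of_real ((x + t *\<^sub>R axis \<nu> 1) $ \<mu>))
    = (\<lambda>t. of_real (x $ \<mu>) + of_real t * (if \<nu> = \<mu> then 1 else 0 :: complex))"
    by (auto simp: axis_def)
  moreover have "((\<lambda>t. of_real (x $ \<mu>) + of_real t * k) has_vector_derivative k) (at 0)" for k :: complex
    unfolding has_vector_derivative_def
    by (auto intro!: derivative_eq_intros simp: scaleR_conv_of_real)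
  ultimately show "((\<lambda>t. of_real ((x + t *\<^sub>R axis \<nu> 1) $ \<mu>)) has_vector_derivative
      (if \<nu> = \<mu> then 1 else 0 :: complex)) (at 0)"
    by simp
qed

lemma partial_add:
  assumes "u differentiable (at x)" "v differentiable (at x)"
  shows "partial \<nu> (\<lambda>x. u x + v x) x = partial \<nu> u x + partial \<nu> v x"
  by (intro partialI has_vector_derivative_add has_vector_derivative_partial assms)

lemma partial_minus:
  assumes "u differentiable (at x)"
  shows "partial \<nu> (\<lambda>x. - u x) x = - partial \<nu> u x"
  by (intro partialI has_vector_derivative_minus has_vector_derivative_partial assms)

lemma partial_sum:
  assumes "\<And>i. i \<in> A \<Longrightarrow> u i differentiable (at x)"
  shows "partial \<nu> (\<lambda>x. \<Sum>i\<in>A. u i x) x = (\<Sum>i\<in>A. partial \<nu> (u i) x)"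
  by (intro partialI has_vector_derivative_sum has_vector_derivative_partial assms)

lemma partial_mult:
  assumes "u differentiable (at x)" "v differentiable (at x)"
  shows "partial \<nu> (\<lambda>x. u x * v x) x = u x * partial \<nu> v x + partial \<nu> u x * v x"
  by (rule partialI)
    (use has_vector_derivative_mult[OF has_vector_derivative_partial[OF assms(1), of \<nu>]
       has_vector_derivative_partial[OF assms(2), of \<nu>]] in simp)

lemma partial_cong:
  assumes "open S" "x \<in> S" "\<And>y. y \<in> S \<Longrightarrow> u y = v y"
  shows "partial \<nu> u x = partial \<nu> v x"
  unfolding partial_def
proof (rule vector_derivative_cong_eq)
  have "((\<lambda>t. x + t *\<^sub>R axis \<nu> 1) \<longlongrightarrow> x) (nhds 0)"
    by (auto intro!: tendsto_eq_intros filterlim_ident)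
  then have "\<forall>\<^sub>F t in nhds 0. x + t *\<^sub>R axis \<nu> 1 \<in> S"
    using assms(1,2) topological_tendstoD by blast
  then show "\<forall>\<^sub>F t in nhds (0::real). t \<in> UNIV \<longrightarrow>
      u (x + t *\<^sub>R axis \<nu> 1) = v (x + t *\<^sub>R axis \<nu> 1)"
    by eventually_elim (use assms(3) in auto)
qed auto

lemma differentiable_on_openD: "open S \<Longrightarrow> u differentiable_on S \<Longrightarrow> x \<in> S \<Longrightarrow> u differentiable (at x)"
  by (simp add: differentiable_on_eq_differentiable_at)

section \<open>Closure properties of smooth functions\<close>

lemma Ck_on_cong:
  assumes "open S" "\<And>x. x \<in> S \<Longrightarrow> u x = v x" "Ck_on k S u"
  shows "Ck_on k S v"
  using assms(2,3)
proof (induction k arbitrary: u v)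
  case 0
  then show ?case by (simp cong: continuous_on_cong)
next
  case (Suc k)
  have "v differentiable (at x)" if x: "x \<in> S" for x
  proof -
    obtain u' where "(u has_derivative u') (at x)"
      using differentiable_on_openD[OF assms(1) _ x] Suc.prems(2)
      by (auto simp: differentiable_def)
    then have "(v has_derivative u') (at x)"
      by (rule has_derivative_transform_within_open[OF _ assms(1) x]) (use Suc.prems in auto)
    then show ?thesis by (auto simp: differentiable_def)
  qed
  moreover have "Ck_on k S (partial \<nu> v)" for \<nu>
    by (rule Suc.IH[OF partial_cong[OF assms(1) _ Suc.prems(1)]])
      (use Suc.prems(2) in simp_all)
  ultimately show ?case
    by (auto simp: differentiable_on_def intro: differentiable_at_withinI)
qed

lemma Ck_on_subset: "Ck_on k S u \<Longrightarrow> T \<subseteq> S \<Longrightarrow> Ck_on k T u"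
  by (induction k arbitrary: u) (auto intro: continuous_on_subset differentiable_on_subset)

lemma Ck_on_Un:
  assumes "open S" "open T"
  shows "Ck_on k S u \<Longrightarrow> Ck_on k T u \<Longrightarrow> Ck_on k (S \<union> T) u"
  using assms
  by (induction k arbitrary: u)
    (auto intro: continuous_on_open_Un simp: differentiable_on_eq_differentiable_at open_Un)

lemma Ck_on_SucD: "Ck_on (Suc k) S u \<Longrightarrow> Ck_on k S u"
  by (induction k arbitrary: u) (auto intro: differentiable_imp_continuous_on)

lemma Ck_on_const: "Ck_on k S (\<lambda>x. c)"
  by (induction k arbitrary: c) (auto simp: differentiable_on_def)

lemma Ck_on_add:
  assumes "open S" "Ck_on k S u" "Ck_on k S v"
  shows "Ck_on k S (\<lambda>x. u x + v x)"
  using assms(2-)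
proof (induction k arbitrary: u v)
  case (Suc k)
  have d: "u differentiable (at x)" "v differentiable (at x)" if "x \<in> S" for x
    using Suc.prems that by (auto intro: differentiable_on_openD[OF assms(1)])
  have "Ck_on k S (partial \<nu> (\<lambda>x. u x + v x))" for \<nu>
    by (rule Ck_on_cong[OF assms(1) _ Suc.IH[of "partial \<nu> u" "partial \<nu> v"]])
      (use Suc.prems d in \<open>auto simp: partial_add\<close>)
  then show ?case using Suc.prems by (auto simp: differentiable_on_def)
qed (auto intro: continuous_intros)

lemma Ck_on_mult:
  assumes "open S" "Ck_on k S u" "Ck_on k S v"
  shows "Ck_on k S (\<lambda>x. u x * v x)"
  using assms(2-)
proof (induction k arbitrary: u v)
  case (Suc k)
  have d: "u differentiable (at x)" "v differentiable (at x)" if "x \<in> S" for x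
    using Suc.prems that by (auto intro: differentiable_on_openD[OF assms(1)])
  have "Ck_on k S (\<lambda>x. u x * partial \<nu> v x + partial \<nu> u x * v x)" for \<nu>
    using Suc.prems by (intro Ck_on_add Suc.IH assms Ck_on_SucD[of k S u] Ck_on_SucD[of k S v]) auto
  then have "Ck_on k S (partial \<nu> (\<lambda>x. u x * v x))" for \<nu>
    by (rule Ck_on_cong[OF assms(1), rotated]) (use d in \<open>auto simp: partial_mult\<close>)
  then show ?case using Suc.prems by (auto simp: differentiable_on_def)
qed (auto intro: continuous_intros)

lemma smooth_on_const: "smooth_on S (\<lambda>x. c)"
  by (simp add: smooth_on_def Ck_on_const)

lemma smooth_on_coord: "smooth_on S (\<lambda>x. of_real (x $ \<mu>))"
proof -
  have "Ck_on k S (\<lambda>x. of_real (x $ \<mu>))" for k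
  proof (cases k)
    case 0
    then show ?thesis by (auto intro!: continuous_intros)
  next
    case (Suc k')
    have "((\<lambda>x::real^'a. complex_of_real (x $ \<mu>)) has_derivative (\<lambda>x. of_real (x $ \<mu>))) (at x within S)" for x
      by (rule has_derivative_of_real[OF bounded_linear_imp_has_derivative[OF bounded_linear_vec_nth]])
    then show ?thesis using Suc
      by (auto simp: partial_coord Ck_on_const differentiable_on_def differentiable_def)
  qed
  then show ?thesis by (simp add: smooth_on_def)
qed

lemma smooth_on_add: "open S \<Longrightarrow> smooth_on S u \<Longrightarrow> smooth_on S v \<Longrightarrow> smooth_on S (\<lambda>x. u x + v x)"
  by (simp add: smooth_on_def Ck_on_add)

lemma smooth_on_mult: "open S \<Longrightarrow> smooth_on S u \<Longrightarrow> smooth_on S v \<Longrightarrow> smooth_on S (\<lambda>x. u x * v x)"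
  by (simp add: smooth_on_def Ck_on_mult)

lemma smooth_on_minus: "open S \<Longrightarrow> smooth_on S u \<Longrightarrow> smooth_on S (\<lambda>x. - u x)"
  using smooth_on_mult[OF _ smooth_on_const[of S "-1"]] by simp

lemma smooth_on_sum:
  "open S \<Longrightarrow> (\<And>i. i \<in> A \<Longrightarrow> smooth_on S (u i)) \<Longrightarrow> smooth_on S (\<lambda>x. \<Sum>i\<in>A. u i x)"
  by (induction A rule: infinite_finite_induct) (auto intro: smooth_on_add smooth_on_const)

lemma smooth_on_partial: "smooth_on S u \<Longrightarrow> smooth_on S (partial \<nu> u)"
  unfolding smooth_on_def by (metis Ck_on.simps(2))

lemma smooth_on_subset: "smooth_on S u \<Longrightarrow> T \<subseteq> S \<Longrightarrow> smooth_on T u"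
  unfolding smooth_on_def using Ck_on_subset by blast

lemma smooth_on_cong:
  "open S \<Longrightarrow> (\<And>x. x \<in> S \<Longrightarrow> u x = v x) \<Longrightarrow> smooth_on S u \<Longrightarrow> smooth_on S v"
  unfolding smooth_on_def using Ck_on_cong by blast

lemma smooth_on_Un:
  "open S \<Longrightarrow> open T \<Longrightarrow> smooth_on S u \<Longrightarrow> smooth_on T u \<Longrightarrow> smooth_on (S \<union> T) u"
  unfolding smooth_on_def using Ck_on_Un by blast

lemma smooth_on_differentiable:
  assumes "open S" "smooth_on S u" "x \<in> S"
  shows "u differentiable (at x)"
proof -
  have "Ck_on (Suc 0) S u" using assms(2) unfolding smooth_on_def by blast
  then show ?thesis using differentiable_on_openD[OF assms(1), of u x] assms(3) by simp
qed

lemma smooth_on_continuous: "smooth_on S u \<Longrightarrow> continuous_on S u"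
  unfolding smooth_on_def by (metis Ck_on.simps(1))

text \<open>Schwarz's argument: the mean value theorem is applied once in each direction. It fails
  for complex values, so a real functional \<open>g\<close>, later the real and the imaginary part,
  is composed first.\<close>

lemma second_difference_mean_value:
  fixes u :: "real^'n \<Rightarrow> complex" and g :: "complex \<Rightarrow> real"
  assumes g: "bounded_linear g" and h: "0 < h"
    and u: "\<And>s t. 0 \<le> s \<Longrightarrow> s \<le> h \<Longrightarrow> 0 \<le> t \<Longrightarrow> t \<le> h \<Longrightarrow>
      u differentiable (at (x + s *\<^sub>R axis \<mu> 1 + t *\<^sub>R axis \<nu> 1)) \<and>
      partial \<mu> u differentiable (at (x + s *\<^sub>R axis \<mu> 1 + t *\<^sub>R axis \<nu> 1))"
  shows "\<exists>s t. 0 < s \<and> s < h \<and> 0 < t \<and> t < h \<and>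
    g (u (x + h *\<^sub>R axis \<mu> 1 + h *\<^sub>R axis \<nu> 1)) - g (u (x + h *\<^sub>R axis \<mu> 1))
      - g (u (x + h *\<^sub>R axis \<nu> 1)) + g (u x)
    = h\<^sup>2 * g (partial \<nu> (partial \<mu> u) (x + s *\<^sub>R axis \<mu> 1 + t *\<^sub>R axis \<nu> 1))"
proof -
  let ?e = "axis \<mu> 1 :: real^'n" and ?f = "axis \<nu> 1 :: real^'n"
  have line: "((\<lambda>t. g (w (y + t *\<^sub>R axis \<kappa> 1))) has_real_derivative g (partial \<kappa> w (y + t *\<^sub>R axis \<kappa> 1))) (at t)"
    if "w differentiable (at (y + t *\<^sub>R axis \<kappa> 1))" for w :: "real^'n \<Rightarrow> complex" and y t \<kappa>
    using bounded_linear.has_vector_derivative[OF g has_vector_derivative_line[OF that]]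
    by (simp add: has_real_derivative_iff_has_vector_derivative)
  define \<Phi> where "\<Phi> s = g (u (x + s *\<^sub>R ?e + h *\<^sub>R ?f)) - g (u (x + s *\<^sub>R ?e))" for s
  have "(\<Phi> has_real_derivative g (partial \<mu> u (x + s *\<^sub>R ?e + h *\<^sub>R ?f)) - g (partial \<mu> u (x + s *\<^sub>R ?e))) (at s)"
    if "0 \<le> s" "s \<le> h" for s
    unfolding \<Phi>_def
    using line[of u "x + h *\<^sub>R ?f" s \<mu>] line[of u x s \<mu>] u[OF that, of h] u[OF that, of 0] h
    by (intro DERIV_diff) (simp_all add: add_ac)
  from MVT2[OF h this] obtain s where s: "0 < s" "s < h" and
    1: "\<Phi> h - \<Phi> 0 = h * (g (partial \<mu> u (x + s *\<^sub>R ?e + h *\<^sub>R ?f)) - g (partial \<mu> u (x + s *\<^sub>R ?e)))"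
    by auto
  have "((\<lambda>t. g (partial \<mu> u (x + s *\<^sub>R ?e + t *\<^sub>R ?f))) has_real_derivative
      g (partial \<nu> (partial \<mu> u) (x + s *\<^sub>R ?e + t *\<^sub>R ?f))) (at t)" if "0 \<le> t" "t \<le> h" for t
    using line[of "partial \<mu> u" "x + s *\<^sub>R ?e" t \<nu>] u[of s t] s that by simp
  from MVT2[OF h this] obtain t where t: "0 < t" "t < h" and
    2: "g (partial \<mu> u (x + s *\<^sub>R ?e + h *\<^sub>R ?f)) - g (partial \<mu> u (x + s *\<^sub>R ?e))
      = h * g (partial \<nu> (partial \<mu> u) (x + s *\<^sub>R ?e + t *\<^sub>R ?f))"
    by auto
  show ?thesis
    using s t 1 unfolding 2 by (intro exI[of _ s] exI[of _ t]) (simp add: \<Phi>_def power2_eq_square)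
qed

lemma second_difference_tendsto:
  fixes u :: "real^'n \<Rightarrow> complex" and g :: "complex \<Rightarrow> real"
  assumes g: "bounded_linear g" and S: "open S" "x \<in> S" and u: "smooth_on S u"
  shows "((\<lambda>h. (g (u (x + h *\<^sub>R axis \<mu> 1 + h *\<^sub>R axis \<nu> 1)) - g (u (x + h *\<^sub>R axis \<mu> 1))
      - g (u (x + h *\<^sub>R axis \<nu> 1)) + g (u x)) / h\<^sup>2) \<longlongrightarrow> g (partial \<nu> (partial \<mu> u) x)) (at_right 0)"
    (is "((\<lambda>h. ?\<Delta> h / _) \<longlongrightarrow> g (?w x)) _")
proof (rule tendstoI)
  fix \<epsilon> :: real assume \<epsilon>: "0 < \<epsilon>"
  have "continuous_on S (\<lambda>y. g (?w y))"
    by (intro bounded_linear.continuous_on[OF g] smooth_on_continuous smooth_on_partial u)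
  then have "isCont (\<lambda>y. g (?w y)) x"
    using S continuous_on_eq_continuous_at by blast
  then obtain d where d: "0 < d" "\<And>y. dist y x < d \<Longrightarrow> dist (g (?w y)) (g (?w x)) < \<epsilon>"
    using \<epsilon> unfolding continuous_at_eps_delta by blast
  obtain d' where d': "0 < d'" "ball x d' \<subseteq> S" using S openE by blast
  \<comment> \<open>Intermediate points have \<open>s + t < 2 * m\<close>, so they lie both in the
    ball given by continuity and in the ball contained in \<open>S\<close>.\<close>
  define m where "m = min d d' / 2"
  have m: "0 < m" "2 * m \<le> d" "2 * m \<le> d'" using d(1) d'(1) by (auto simp: m_def)
  have near: "dist (x + s *\<^sub>R axis \<mu> 1 + t *\<^sub>R axis \<nu> 1) x \<le> s + t" if "0 \<le> s" "0 \<le> t" for s t :: real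
  proof -
    have "norm (s *\<^sub>R axis \<mu> 1 + t *\<^sub>R axis \<nu> (1::real)) \<le> s + t"
      by (rule order_trans[OF norm_triangle_ineq]) (use that in simp)
    then show ?thesis by (simp add: dist_norm add.assoc)
  qed
  show "\<forall>\<^sub>F h in at_right 0. dist (?\<Delta> h / h\<^sup>2) (g (?w x)) < \<epsilon>"
    unfolding eventually_at_right_field
  proof (intro exI[of _ m] conjI allI impI)
    fix h :: real assume h: "0 < h" "h < m"
    have "\<exists>s t. 0 < s \<and> s < h \<and> 0 < t \<and> t < h \<and>
      ?\<Delta> h = h\<^sup>2 * g (?w (x + s *\<^sub>R axis \<mu> 1 + t *\<^sub>R axis \<nu> 1))"
    proof (rule second_difference_mean_value[OF g h(1)])
      fix s t assume st: "0 \<le> s" "s \<le> h" "0 \<le> t" "t \<le> h"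
      then have "dist x (x + s *\<^sub>R axis \<mu> 1 + t *\<^sub>R axis \<nu> 1) < d'"
        using near[of s t] h m by (simp add: dist_commute)
      then have "x + s *\<^sub>R axis \<mu> 1 + t *\<^sub>R axis \<nu> 1 \<in> S" using d'(2) by auto
      then show "u differentiable (at (x + s *\<^sub>R axis \<mu> 1 + t *\<^sub>R axis \<nu> 1)) \<and>
          partial \<mu> u differentiable (at (x + s *\<^sub>R axis \<mu> 1 + t *\<^sub>R axis \<nu> 1))"
        using smooth_on_differentiable[OF S(1)] u smooth_on_partial by blast
    qed
    then obtain s t where st: "0 < s" "s < h" "0 < t" "t < h"
      and eq: "?\<Delta> h = h\<^sup>2 * g (?w (x + s *\<^sub>R axis \<mu> 1 + t *\<^sub>R axis \<nu> 1))" by blast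
    have "dist (x + s *\<^sub>R axis \<mu> 1 + t *\<^sub>R axis \<nu> 1) x < d"
      using near[of s t] st h m by simp
    then show "dist (?\<Delta> h / h\<^sup>2) (g (?w x)) < \<epsilon>"
      unfolding eq using d(2) h(1) by simp
  qed (rule m)
qed

text \<open>The second difference quotient is symmetric in the two directions, so both mixed
  derivatives are its limit.\<close>

lemma partial_commute:
  fixes u :: "real^'n \<Rightarrow> complex"
  assumes S: "open S" "x \<in> S" and u: "smooth_on S u"
  shows "partial \<nu> (partial \<mu> u) x = partial \<mu> (partial \<nu> u) x"
proof -
  have "g (partial \<nu> (partial \<mu> u) x) = g (partial \<mu> (partial \<nu> u) x)"
    if g: "bounded_linear g" for g :: "complex \<Rightarrow> real"
  proof (rule tendsto_unique[OF trivial_limit_at_right_real])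
    show "((\<lambda>h. (g (u (x + h *\<^sub>R axis \<mu> 1 + h *\<^sub>R axis \<nu> 1)) - g (u (x + h *\<^sub>R axis \<mu> 1))
      - g (u (x + h *\<^sub>R axis \<nu> 1)) + g (u x)) / h\<^sup>2) \<longlongrightarrow> g (partial \<nu> (partial \<mu> u) x)) (at_right 0)"
      by (rule second_difference_tendsto[OF g S u])
    show "((\<lambda>h. (g (u (x + h *\<^sub>R axis \<mu> 1 + h *\<^sub>R axis \<nu> 1)) - g (u (x + h *\<^sub>R axis \<mu> 1))
      - g (u (x + h *\<^sub>R axis \<nu> 1)) + g (u x)) / h\<^sup>2) \<longlongrightarrow> g (partial \<mu> (partial \<nu> u) x)) (at_right 0)"
      using second_difference_tendsto[OF g S u, of \<nu> \<mu>] by (simp add: algebra_simps)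
  qed
  from this[OF bounded_linear_Re] this[OF bounded_linear_Im] show ?thesis
    by (rule complex_eqI)
qed

section \<open>Test functions and integration against them\<close>

lemma test_function_smooth: "\<phi> \<in> test_functions U \<Longrightarrow> smooth_on UNIV \<phi>"
  by (simp add: test_functions_def)

lemma test_functionI:
  assumes "smooth_on UNIV \<psi>" "\<phi> \<in> test_functions U" "{x. \<psi> x \<noteq> 0} \<subseteq> closure {x. \<phi> x \<noteq> 0}"
  shows "\<psi> \<in> test_functions U"
proof -
  let ?K = "closure {x. \<phi> x \<noteq> 0}" and ?L = "closure {x. \<psi> x \<noteq> 0}"
  have L: "?L \<subseteq> ?K"
    using assms(3) by (rule closure_minimal) (rule closed_closure)
  have K: "compact ?K" "?K \<subseteq> U" using assms(2) by (simp_all add: test_functions_def)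
  have "compact ?L"
    using compact_Int_closed[OF K(1) closed_closure, of "{x. \<psi> x \<noteq> 0}"] L
    by (simp only: inf.absorb2)
  then show ?thesis
    using assms(1) L K(2) unfolding test_functions_def by blast
qed

lemma test_function_partial:
  assumes "\<phi> \<in> test_functions U"
  shows "partial \<nu> \<phi> \<in> test_functions U"
proof (rule test_functionI[OF _ assms])
  show "smooth_on UNIV (partial \<nu> \<phi>)"
    using assms by (intro smooth_on_partial test_function_smooth)
  have "partial \<nu> \<phi> x = 0" if x: "x \<notin> closure {x. \<phi> x \<noteq> 0}" for x
  proof -
    have "partial \<nu> \<phi> x = partial \<nu> (\<lambda>_. 0) x"
    proof (rule partial_cong)
      show "open (- closure {x. \<phi> x \<noteq> 0})" "x \<in> - closure {x. \<phi> x \<noteq> 0}"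
        using x by auto
      show "\<phi> y = 0" if "y \<in> - closure {x. \<phi> x \<noteq> 0}" for y
        using that closure_subset[of "{x. \<phi> x \<noteq> 0}"] by blast
    qed
    then show ?thesis by simp
  qed
  then show "{x. partial \<nu> \<phi> x \<noteq> 0} \<subseteq> closure {x. \<phi> x \<noteq> 0}" by blast
qed

lemma test_function_zero: "\<phi> \<in> test_functions U \<Longrightarrow> x \<notin> U \<Longrightarrow> \<phi> x = 0"
  using closure_subset[of "{x. \<phi> x \<noteq> 0}"] by (auto simp: test_functions_def)

text \<open>The product is smooth on \<open>\<Omega>\<close> and identically 0 on the complement of
  the support of \<open>\<phi>\<close>; these two open sets cover the space.\<close>

lemma test_function_mult:
  assumes "open \<Omega>" "U \<subseteq> \<Omega>" "smooth_on \<Omega> g" "\<phi> \<in> test_functions U"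
  shows "(\<lambda>x. g x * \<phi> x) \<in> test_functions U"
proof (rule test_functionI[OF _ assms(4)])
  let ?K = "closure {x. \<phi> x \<noteq> 0}"
  have sub: "{x. \<phi> x \<noteq> 0} \<subseteq> ?K" by (rule closure_subset)
  have "smooth_on (- ?K) (\<lambda>x. g x * \<phi> x)"
    by (rule smooth_on_cong[OF _ _ smooth_on_const[of _ 0]]) (use sub in auto)
  moreover have "smooth_on \<Omega> (\<lambda>x. g x * \<phi> x)"
    by (intro smooth_on_mult assms smooth_on_subset[OF test_function_smooth[OF assms(4)]]) auto
  ultimately have "smooth_on (- ?K \<union> \<Omega>) (\<lambda>x. g x * \<phi> x)"
    by (intro smooth_on_Un assms) auto
  moreover have "- ?K \<union> \<Omega> = UNIV" using assms(2,4) by (auto simp: test_functions_def)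
  ultimately show "smooth_on UNIV (\<lambda>x. g x * \<phi> x)" by simp
  show "{x. g x * \<phi> x \<noteq> 0} \<subseteq> ?K" using sub by auto
qed

lemma test_function_add:
  assumes "\<phi> \<in> test_functions U" "\<psi> \<in> test_functions U"
  shows "(\<lambda>x. \<phi> x + \<psi> x) \<in> test_functions U"
proof -
  let ?K = "closure {x. \<phi> x \<noteq> 0} \<union> closure {x. \<psi> x \<noteq> 0}"
  have "closure {x. \<phi> x + \<psi> x \<noteq> 0} \<subseteq> ?K"
    proof (rule closure_minimal)
    have "{x. \<phi> x + \<psi> x \<noteq> 0} \<subseteq> {x. \<phi> x \<noteq> 0} \<union> {x. \<psi> x \<noteq> 0}" by auto
    then show "{x. \<phi> x + \<psi> x \<noteq> 0} \<subseteq> ?K"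
      using closure_subset[of "{x. \<phi> x \<noteq> 0}"] closure_subset[of "{x. \<psi> x \<noteq> 0}"] by blast
  qed auto
  moreover have K: "compact ?K" "?K \<subseteq> U" using assms by (auto simp: test_functions_def)
  moreover have "compact (closure {x. \<phi> x + \<psi> x \<noteq> 0})"
    using compact_Int_closed[OF K(1) closed_closure, of "{x. \<phi> x + \<psi> x \<noteq> 0}"] calculation(1)
    by (simp only: inf.absorb2)
  moreover have "smooth_on UNIV (\<lambda>x. \<phi> x + \<psi> x)"
    using assms by (intro smooth_on_add test_function_smooth) auto
  ultimately show ?thesis
    unfolding test_functions_def by blast
qed

lemma test_function_0: "(\<lambda>x. 0) \<in> test_functions U"
  by (simp add: test_functions_def smooth_on_const)

lemma test_function_sum:
  "(\<And>i. i \<in> A \<Longrightarrow> \<phi> i \<in> test_functions U) \<Longrightarrow> (\<lambda>x. \<Sum>i\<in>A. \<phi> i x) \<in> test_functions U"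
  by (induction A rule: infinite_finite_induct) (auto intro: test_function_add test_function_0)

lemma test_function_minus:
  assumes "\<phi> \<in> test_functions U"
  shows "(\<lambda>x. - \<phi> x) \<in> test_functions U"
  using test_function_mult[OF open_UNIV _ smooth_on_const[of UNIV "-1"] assms] by simp

text \<open>Equality is wanted at every point, since functionals take whole functions as arguments.
  Off \<open>U\<close>, where \<open>g\<close> need not be differentiable, \<open>\<phi>\<close> and
  the derivatives of both test functions vanish.\<close>

lemma partial_mult_test:
  assumes "open \<Omega>" "U \<subseteq> \<Omega>" "smooth_on \<Omega> g" "\<phi> \<in> test_functions U"
  shows "partial \<nu> (\<lambda>x. g x * \<phi> x) x = g x * partial \<nu> \<phi> x + partial \<nu> g x * \<phi> x"
proof (cases "x \<in> U")
  case True
  then show ?thesis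
    using assms by (intro partial_mult smooth_on_differentiable[of \<Omega>]
        smooth_on_differentiable[OF _ test_function_smooth[OF assms(4)]]) auto
next
  case False
  with test_function_zero[OF assms(4)] test_function_zero[OF test_function_partial[OF assms(4)]]
    test_function_zero[OF test_function_partial[OF test_function_mult[OF assms]]]
  show ?thesis by simp
qed

lemma integrable_L2_loc_test:
  assumes "open U" "f \<in> L2_loc U" "\<phi> \<in> test_functions U"
  shows "integrable (lebesgue_on U) (\<lambda>x. f x * \<phi> x)"
proof -
  let ?K = "closure {x. \<phi> x \<noteq> 0}"
  have K: "compact ?K" "?K \<subseteq> U" using assms(3) by (auto simp: test_functions_def)
  have sets: "?K \<in> sets lebesgue" "U \<in> sets lebesgue"
    using assms(1) by (auto intro: lmeasurable_compact fmeasurableD K)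
  have cont: "continuous_on UNIV \<phi>"
    using assms(3) by (intro smooth_on_continuous test_function_smooth)
  obtain B where B: "\<And>x. x \<in> ?K \<Longrightarrow> norm (\<phi> x) \<le> B"
    using compact_imp_bounded[OF compact_continuous_image[OF continuous_on_subset[OF cont] K(1)]]
    by (auto simp: bounded_iff)
  have "f \<in> borel_measurable (lebesgue_on U)" using assms(2) by (simp add: L2_loc_def)
  then have fK: "f \<in> borel_measurable (lebesgue_on ?K)"
    by (rule measurable_restrict_mono) (rule K)
  have \<phi>K: "\<phi> \<in> borel_measurable (lebesgue_on ?K)"
    by (rule continuous_imp_measurable_on_sets_lebesgue[OF continuous_on_subset[OF cont] sets(1)]) auto
  \<comment> \<open>The dominating function: \<open>norm (f x)\<close> is at most 1 plus its square,
    and \<open>B\<close> bounds \<open>\<phi>\<close> on its compact support.\<close>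
  have "integrable (lebesgue_on ?K) (\<lambda>x. (1 + (norm (f x))\<^sup>2) * B)"
  proof (intro integrable_mult_left Bochner_Integration.integrable_add)
    show "integrable (lebesgue_on ?K) (\<lambda>x. 1 :: real)"
      using finite_measure.integrable_const[OF finite_measure_lebesgue_on[OF lmeasurable_compact[OF K(1)]]] .
    show "integrable (lebesgue_on ?K) (\<lambda>x. (norm (f x))\<^sup>2)"
      using assms(2) K by (auto simp: L2_loc_def)
  qed
  then have "integrable (lebesgue_on ?K) (\<lambda>x. f x * \<phi> x)"
  proof (rule Bochner_Integration.integrable_bound)
    show "(\<lambda>x. f x * \<phi> x) \<in> borel_measurable (lebesgue_on ?K)" using fK \<phi>K by measurable
    have "norm (f x * \<phi> x) \<le> norm ((1 + (norm (f x))\<^sup>2) * B)" if "x \<in> ?K" for x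
    proof -
      have "norm (f x) \<le> 1 + (norm (f x))\<^sup>2"
        by (smt (verit) power2_eq_square mult_left_le mult_le_cancel_right1 norm_ge_zero zero_le_power2)
      moreover have "0 \<le> B" using B[OF that] norm_ge_zero order_trans by blast
      ultimately have "norm (f x) * norm (\<phi> x) \<le> (1 + (norm (f x))\<^sup>2) * B"
        using B[OF that] by (intro mult_mono) auto
      then show ?thesis by (simp add: norm_mult)
    qed
    then show "AE x in lebesgue_on ?K. norm (f x * \<phi> x) \<le> norm ((1 + (norm (f x))\<^sup>2) * B)"
      by (intro AE_I2) (simp add: space_restrict_space)
  qed
  then have "integrable lebesgue (\<lambda>x. indicator ?K x *\<^sub>R (f x * \<phi> x))"
    using sets by (simp add: integrable_restrict_space)
  also have "(\<lambda>x. indicator ?K x *\<^sub>R (f x * \<phi> x)) = (\<lambda>x. indicator U x *\<^sub>R (f x * \<phi> x))"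
    using closure_subset[of "{x. \<phi> x \<noteq> 0}"] K(2) by (auto simp: indicator_def fun_eq_iff)
  finally show ?thesis using sets by (simp add: integrable_restrict_space)
qed

section \<open>Operators on distributions\<close>

lemma principal_op_const [simp]: "principal_op a j (\<lambda>x. k) = (\<lambda>x. 0)"
  by (rule ext) (simp add: principal_op_def)

lemma principal_op_coord: "principal_op a j (\<lambda>x. of_real (x $ \<mu>)) = a j \<mu>"
  by (rule ext) (simp add: principal_op_def partial_coord mult_delta_right)

lemma principal_op_add:
  assumes "u differentiable (at x)" "v differentiable (at x)"
  shows "principal_op a j (\<lambda>x. u x + v x) x = principal_op a j u x + principal_op a j v x"
  by (simp add: principal_op_def partial_add[OF assms] distrib_left sum.distrib)

lemma principal_op_minus:
  assumes "u differentiable (at x)"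
  shows "principal_op a j (\<lambda>x. - u x) x = - principal_op a j u x"
  by (simp add: principal_op_def partial_minus[OF assms] sum_negf)

lemma principal_op_diff:
  assumes "u differentiable (at x)" "v differentiable (at x)"
  shows "principal_op a j (\<lambda>x. u x - v x) x = principal_op a j u x - principal_op a j v x"
  using principal_op_add[OF assms(1) differentiable_minus[OF assms(2)], of a j]
  by (simp add: principal_op_minus[OF assms(2)])

lemma principal_op_mult:
  assumes "u differentiable (at x)" "v differentiable (at x)"
  shows "principal_op a j (\<lambda>x. u x * v x) x = u x * principal_op a j v x + principal_op a j u x * v x"
  by (simp add: principal_op_def partial_mult[OF assms] distrib_left sum.distrib
      sum_distrib_left sum_distrib_right mult_ac)

text \<open>Additivity allows values on several test functions to be collected into one. It holds
  for integration against \<open>L2_loc\<close> functions and is inherited under \<open>Pop\<close>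
  and \<open>Cop\<close>.\<close>

definition additive_functionals :: "(real^'n) set \<Rightarrow> 'n::finite functional set" where
  "additive_functionals U = {T. \<forall>\<phi>\<in>test_functions U. \<forall>\<psi>\<in>test_functions U.
     T (\<lambda>x. \<phi> x + \<psi> x) = T \<phi> + T \<psi>}"

lemma additive_functionals_add:
  "T \<in> additive_functionals U \<Longrightarrow> \<phi> \<in> test_functions U \<Longrightarrow> \<psi> \<in> test_functions U \<Longrightarrow>
    T (\<lambda>x. \<phi> x + \<psi> x) = T \<phi> + T \<psi>"
  by (simp add: additive_functionals_def)

lemma additive_functionals_0: "T \<in> additive_functionals U \<Longrightarrow> T (\<lambda>x. 0) = 0"
  using additive_functionals_add[OF _ test_function_0 test_function_0] by simp

lemma additive_functionals_minus:
  assumes "T \<in> additive_functionals U" "\<phi> \<in> test_functions U"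
  shows "T (\<lambda>x. - \<phi> x) = - T \<phi>"
  using additive_functionals_add[OF assms test_function_minus[OF assms(2)]]
    additive_functionals_0[OF assms(1)] by (simp add: add_eq_0_iff)

lemma additive_functionals_diff:
  assumes "T \<in> additive_functionals U" "\<phi> \<in> test_functions U" "\<psi> \<in> test_functions U"
  shows "T (\<lambda>x. \<phi> x - \<psi> x) = T \<phi> - T \<psi>"
  using additive_functionals_add[OF assms(1,2) test_function_minus[OF assms(3)]]
    additive_functionals_minus[OF assms(1,3)] by simp

lemma additive_functionals_sum:
  assumes "T \<in> additive_functionals U" "\<And>i. i \<in> A \<Longrightarrow> \<phi> i \<in> test_functions U"
  shows "T (\<lambda>x. \<Sum>i\<in>A. \<phi> i x) = (\<Sum>i\<in>A. T (\<phi> i))"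
  using assms(2)
proof (induction A rule: infinite_finite_induct)
  case (insert i A)
  then show ?case
    using additive_functionals_add[OF assms(1), of "\<phi> i" "\<lambda>x. \<Sum>i\<in>A. \<phi> i x"]
    by (simp add: test_function_sum)
qed (simp_all add: additive_functionals_0[OF assms(1)])

text \<open>The free indices range over all natural numbers because \<open>D\<close> accepts
  arbitrary lists; the summed ones stay in \<open>1..r\<close>.\<close>

locale involutive_frame =
  fixes \<Omega> U :: "(real^'n::finite) set"
    and r :: nat
    and a :: "nat \<Rightarrow> 'n \<Rightarrow> real^'n \<Rightarrow> complex"
    and a0 :: "nat \<Rightarrow> real^'n \<Rightarrow> complex"
    and c :: "nat \<Rightarrow> nat \<Rightarrow> nat \<Rightarrow> real^'n \<Rightarrow> complex"
  assumes open_\<Omega>: "open \<Omega>"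
    and U_\<Omega>: "U \<subseteq> \<Omega>"
    and smooth_a: "smooth_on \<Omega> (a j \<nu>)"
    and smooth_a0: "smooth_on \<Omega> (a0 j)"
    and smooth_c: "smooth_on \<Omega> (c j k l)"
    and commutator: "smooth_on \<Omega> u \<Longrightarrow> x \<in> \<Omega> \<Longrightarrow>
      diff_op a a0 j (diff_op a a0 k u) x - diff_op a a0 k (diff_op a a0 j u) x
        = (\<Sum>l=1..r. c j k l x * diff_op a a0 l u x)"
    and antisym: "x \<in> \<Omega> \<Longrightarrow> c j k l x = - c k j l x"
    and jacobi: "x \<in> \<Omega> \<Longrightarrow>
      (\<Sum>s=1..r. c k k' s x * c s l' l x + c k' l' s x * c s k l x + c l' k s x * c s k' l x)
        = principal_op a l' (c k k' l) x + principal_op a k (c k' l' l) x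
          + principal_op a k' (c l' k l) x"
begin

abbreviation "p \<equiv> principal_op a"
abbreviation "X \<equiv> test_functions U"

section \<open>Structure equations for the coefficients\<close>

lemma smooth_p: "smooth_on \<Omega> u \<Longrightarrow> smooth_on \<Omega> (p j u)"
  unfolding principal_op_def[abs_def]
  by (intro smooth_on_sum smooth_on_mult smooth_on_partial smooth_a open_\<Omega>)

lemma diff: "smooth_on \<Omega> u \<Longrightarrow> x \<in> \<Omega> \<Longrightarrow> u differentiable (at x)"
  by (rule smooth_on_differentiable[OF open_\<Omega>])

lemma p_a0: "x \<in> \<Omega> \<Longrightarrow> p j (a0 k) x - p k (a0 j) x = (\<Sum>l=1..r. c j k l x * a0 l x)"
proof -
  have one: "diff_op a a0 k (\<lambda>x. 1) = a0 k" for k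
    by (rule ext) (simp add: diff_op_def)
  assume "x \<in> \<Omega>"
  from commutator[OF smooth_on_const[of _ 1] this, of j k] show ?thesis
    unfolding one by (simp add: diff_op_def)
qed

text \<open>The terms \<open>a0 k x * p j u x\<close> and \<open>a0 j x * p k u x\<close> together
  are symmetric in \<open>j\<close> and \<open>k\<close>, so they drop out of the commutator;
  \<open>p_a0\<close> accounts for the terms with \<open>u\<close> undifferentiated.\<close>

lemma p_commutator:
  assumes u: "smooth_on \<Omega> u" and x: "x \<in> \<Omega>"
  shows "p j (p k u) x - p k (p j u) x = (\<Sum>l=1..r. c j k l x * p l u x)"
proof -
  have *: "diff_op a a0 j (diff_op a a0 k u) x
    = p j (p k u) x + a0 k x * p j u x + p j (a0 k) x * u x + a0 j x * p k u x + a0 j x * a0 k x * u x"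
    for j k
  proof -
    have "diff_op a a0 k u = (\<lambda>x. p k u x + a0 k x * u x)"
      by (rule ext) (simp add: diff_op_def)
    then have "p j (diff_op a a0 k u) x = p j (p k u) x + (a0 k x * p j u x + p j (a0 k) x * u x)"
      using x u by (simp add: principal_op_add principal_op_mult diff smooth_p smooth_a0
          smooth_on_mult open_\<Omega>)
    then show ?thesis by (simp add: diff_op_def algebra_simps)
  qed
  have "(\<Sum>l=1..r. c j k l x * diff_op a a0 l u x)
      = (\<Sum>l=1..r. c j k l x * p l u x) + (\<Sum>l=1..r. c j k l x * a0 l x) * u x"
    unfolding sum_distrib_right sum.distrib[symmetric]
    by (rule sum.cong[OF refl]) (simp add: diff_op_def algebra_simps)
  with commutator[OF u x, of j k] show ?thesis
    unfolding * p_a0[OF x, symmetric] by (simp add: algebra_simps)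
qed

lemma p_a: "x \<in> \<Omega> \<Longrightarrow> p j (a k \<mu>) x - p k (a j \<mu>) x = (\<Sum>l=1..r. c j k l x * a l \<mu> x)"
  using p_commutator[OF smooth_on_coord[of \<Omega> \<mu>], of x j k] by (simp add: principal_op_coord)

text \<open>Transposing \<open>p j\<close> differentiates the products
  \<open>a j \<nu> x * \<phi> x\<close>; the part in which \<open>\<phi>\<close> is not
  differentiated contributes the divergence, whence the zeroth order coefficient
  \<open>d0\<close>.\<close>

definition divergence :: "nat \<Rightarrow> real^'n \<Rightarrow> complex" where
  "divergence j x = (\<Sum>\<nu>\<in>UNIV. partial \<nu> (a j \<nu>) x)"

lemma smooth_divergence: "smooth_on \<Omega> (divergence j)"
  unfolding divergence_def[abs_def] by (intro smooth_on_sum smooth_on_partial smooth_a open_\<Omega>)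

text \<open>The divergence of the identity \<open>p_a\<close>. On the left, products of two first
  derivatives form the symmetric \<open>M\<close>, and second derivatives regroup after being
  commuted; on the right, div(cX) = c div X + X(c).\<close>

lemma divergence_commutator:
  assumes x: "x \<in> \<Omega>"
  shows "p j (divergence k) x - p k (divergence j) x
    = (\<Sum>l=1..r. p l (c j k l) x + c j k l x * divergence l x)"
proof -
  define M where "M j k = (\<Sum>\<mu>\<in>UNIV. \<Sum>\<nu>\<in>UNIV. partial \<mu> (a j \<nu>) x * partial \<nu> (a k \<mu>) x)" for j k
  have M_sym: "M j k = M k j"
    unfolding M_def by (subst sum.swap) (simp add: mult.commute)
  have div_p: "(\<Sum>\<mu>\<in>UNIV. partial \<mu> (p j (a k \<mu>)) x) = p j (divergence k) x + M j k" for j k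
  proof -
    have "(\<Sum>\<mu>\<in>UNIV. partial \<mu> (p j (a k \<mu>)) x)
      = (\<Sum>\<mu>\<in>UNIV. \<Sum>\<nu>\<in>UNIV. a j \<nu> x * partial \<mu> (partial \<nu> (a k \<mu>)) x) + M j k"
      unfolding principal_op_def[abs_def] M_def sum.distrib[symmetric]
      by (intro sum.cong refl)
        (simp add: partial_sum partial_mult diff smooth_on_mult smooth_on_partial smooth_a open_\<Omega> x
          sum.distrib)
    also have "(\<Sum>\<mu>\<in>UNIV. \<Sum>\<nu>\<in>UNIV. a j \<nu> x * partial \<mu> (partial \<nu> (a k \<mu>)) x)
      = (\<Sum>\<nu>\<in>UNIV. \<Sum>\<mu>\<in>UNIV. a j \<nu> x * partial \<nu> (partial \<mu> (a k \<mu>)) x)"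
      by (subst sum.swap) (simp add: partial_commute[OF open_\<Omega> x smooth_a])
    also have "\<dots> = p j (divergence k) x"
      unfolding principal_op_def divergence_def[abs_def]
      by (simp add: partial_sum diff smooth_on_partial smooth_a x sum_distrib_left)
    finally show ?thesis .
  qed
  have "partial \<mu> (p j (a k \<mu>)) x - partial \<mu> (p k (a j \<mu>)) x
      = (\<Sum>l=1..r. c j k l x * partial \<mu> (a l \<mu>) x + partial \<mu> (c j k l) x * a l \<mu> x)" for \<mu>
  proof -
    have "partial \<mu> (p j (a k \<mu>)) x + - partial \<mu> (p k (a j \<mu>)) x
      = partial \<mu> (\<lambda>x. p j (a k \<mu>) x + - p k (a j \<mu>) x) x"
      by (simp only: partial_add partial_minus diff differentiable_minus smooth_p smooth_a x)
    also have "\<dots> = partial \<mu> (\<lambda>x. \<Sum>l=1..r. c j k l x * a l \<mu> x) x"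
      by (rule partial_cong[OF open_\<Omega> x]) (use p_a in simp)
    also have "\<dots> = (\<Sum>l=1..r. c j k l x * partial \<mu> (a l \<mu>) x + partial \<mu> (c j k l) x * a l \<mu> x)"
      by (simp add: partial_sum partial_mult diff smooth_on_mult smooth_a smooth_c open_\<Omega> x)
    finally show ?thesis by simp
  qed
  then have "(\<Sum>\<mu>\<in>UNIV. partial \<mu> (p j (a k \<mu>)) x) - (\<Sum>\<mu>\<in>UNIV. partial \<mu> (p k (a j \<mu>)) x)
    = (\<Sum>\<mu>\<in>UNIV. \<Sum>l=1..r. c j k l x * partial \<mu> (a l \<mu>) x + partial \<mu> (c j k l) x * a l \<mu> x)"
    by (simp add: sum_subtractf[symmetric])
  also have "\<dots> = (\<Sum>l=1..r. p l (c j k l) x + c j k l x * divergence l x)"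
    by (subst sum.swap)
      (simp add: principal_op_def divergence_def sum.distrib sum_distrib_left mult_ac add_ac)
  finally show ?thesis
    unfolding div_p using M_sym by simp
qed

definition d0 :: "nat \<Rightarrow> real^'n \<Rightarrow> complex" where
  "d0 j x = a0 j x - divergence j x"

text \<open>\<open>adj j\<close> is the formal transpose of \<open>P\<^sub>j\<close>.\<close>

definition adj :: "nat \<Rightarrow> (real^'n \<Rightarrow> complex) \<Rightarrow> real^'n \<Rightarrow> complex" where
  "adj j \<phi> x = d0 j x * \<phi> x - p j \<phi> x"

lemma smooth_d0: "smooth_on \<Omega> (d0 j)"
  using smooth_on_add[OF open_\<Omega> smooth_a0 smooth_on_minus[OF open_\<Omega> smooth_divergence], of j j]
  unfolding d0_def[abs_def] by simp

text \<open>The extra \<open>p l (c j k l) x\<close> comes from the divergence; in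
  \<open>adj_commutator\<close> it lets multiplication by \<open>c j k l\<close> move inside
  \<open>adj l\<close>.\<close>

lemma d0_commutator:
  assumes x: "x \<in> \<Omega>"
  shows "p j (d0 k) x - p k (d0 j) x = (\<Sum>l=1..r. c j k l x * d0 l x - p l (c j k l) x)"
proof -
  have "p j (d0 k) x = p j (a0 k) x - p j (divergence k) x" for j k
    unfolding d0_def[abs_def] by (simp add: principal_op_diff diff smooth_a0 smooth_divergence x)
  then have "p j (d0 k) x - p k (d0 j) x
    = (p j (a0 k) x - p k (a0 j) x) - (p j (divergence k) x - p k (divergence j) x)" by simp
  then show ?thesis
    unfolding p_a0[OF x] divergence_commutator[OF x]
    by (simp add: d0_def algebra_simps sum.distrib sum_subtractf)
qed

section \<open>Formal transposes acting on test functions\<close>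

lemma mult_X: "smooth_on \<Omega> g \<Longrightarrow> \<phi> \<in> X \<Longrightarrow> (\<lambda>x. g x * \<phi> x) \<in> X"
  by (rule test_function_mult[OF open_\<Omega> U_\<Omega>])

lemma X_smooth: "\<phi> \<in> X \<Longrightarrow> smooth_on \<Omega> \<phi>"
  using test_function_smooth smooth_on_subset by blast

lemma p_X: "\<phi> \<in> X \<Longrightarrow> p j \<phi> \<in> X"
  unfolding principal_op_def[abs_def]
  by (intro test_function_sum mult_X smooth_a test_function_partial)

lemma adj_X: "\<phi> \<in> X \<Longrightarrow> adj j \<phi> \<in> X"
  using test_function_add[OF mult_X[OF smooth_d0] test_function_minus[OF p_X], of \<phi> \<phi> j j]
  unfolding adj_def[abs_def] by simp

lemma p_mult_X:
  assumes "smooth_on \<Omega> g" "\<phi> \<in> X"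
  shows "p j (\<lambda>x. g x * \<phi> x) x = g x * p j \<phi> x + p j g x * \<phi> x"
  unfolding principal_op_def partial_mult_test[OF open_\<Omega> U_\<Omega> assms]
  by (simp add: distrib_left sum.distrib sum_distrib_left sum_distrib_right mult_ac)

lemma adj_mult:
  assumes "smooth_on \<Omega> g" "\<phi> \<in> X"
  shows "adj j (\<lambda>x. g x * \<phi> x) x = g x * adj j \<phi> x - p j g x * \<phi> x"
  unfolding adj_def p_mult_X[OF assms] by (simp add: algebra_simps)

lemma adj_add:
  assumes "\<phi> \<in> X" "\<psi> \<in> X"
  shows "adj j (\<lambda>x. \<phi> x + \<psi> x) = (\<lambda>x. adj j \<phi> x + adj j \<psi> x)"
proof
  fix x
  have "\<phi> differentiable (at x)" "\<psi> differentiable (at x)"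
    by (auto intro: smooth_on_differentiable[OF open_UNIV] test_function_smooth assms)
  from principal_op_add[OF this, of a j]
  show "adj j (\<lambda>x. \<phi> x + \<psi> x) x = adj j \<phi> x + adj j \<psi> x"
    unfolding adj_def by (simp add: distrib_left)
qed

text \<open>Transposition reverses products: hence the order of \<open>k\<close> and
  \<open>j\<close> on the left, and on the right the multiplication by \<open>c j k l\<close> before
  \<open>adj l\<close>. Off \<open>U\<close> both sides vanish, being built from test
  functions.\<close>

lemma adj_commutator:
  assumes \<phi>: "\<phi> \<in> X"
  shows "adj k (adj j \<phi>) x - adj j (adj k \<phi>) x = (\<Sum>l=1..r. adj l (\<lambda>x. c j k l x * \<phi> x) x)"
proof (cases "x \<in> U")
  case False
  have "adj i \<psi> x = 0" if "\<psi> \<in> X" for i \<psi>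
    using test_function_zero[OF adj_X[OF that] False] .
  then show ?thesis using \<phi> by (simp add: adj_X mult_X smooth_c)
next
  case True
  then have x: "x \<in> \<Omega>" using U_\<Omega> by blast
  note s = X_smooth[OF \<phi>]
  have *: "adj k (adj j \<phi>) x = d0 k x * d0 j x * \<phi> x - d0 k x * p j \<phi> x
    - d0 j x * p k \<phi> x - p k (d0 j) x * \<phi> x + p k (p j \<phi>) x" for k j
  proof -
    have "p k (adj j \<phi>) x = d0 j x * p k \<phi> x + p k (d0 j) x * \<phi> x - p k (p j \<phi>) x"
      unfolding adj_def[abs_def]
      by (simp add: principal_op_diff principal_op_mult diff smooth_on_mult smooth_d0 s smooth_p open_\<Omega> x)
    then show ?thesis by (simp add: adj_def algebra_simps)
  qed
  have "adj k (adj j \<phi>) x - adj j (adj k \<phi>) x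
    = (p j (d0 k) x - p k (d0 j) x) * \<phi> x - (p j (p k \<phi>) x - p k (p j \<phi>) x)"
    unfolding * by (simp add: algebra_simps)
  also have "\<dots> = (\<Sum>l=1..r. adj l (\<lambda>x. c j k l x * \<phi> x) x)"
    unfolding d0_commutator[OF x] p_commutator[OF s x] adj_mult[OF smooth_c \<phi>]
    unfolding adj_def sum_distrib_right sum_subtractf[symmetric]
    by (rule sum.cong[OF refl]) (simp add: algebra_simps)
  finally show ?thesis .
qed

text \<open>Functionals are cut off to \<open>0\<close> outside the test functions, so that equality on test functions
  becomes equality.\<close>

definition Pop :: "nat \<Rightarrow> 'n functional \<Rightarrow> 'n functional" where
  "Pop j T = (\<lambda>\<phi>. if \<phi> \<in> X then dist_diff_op a a0 j T \<phi> else 0)"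

definition Cop :: "nat \<Rightarrow> nat \<Rightarrow> nat \<Rightarrow> 'n functional \<Rightarrow> 'n functional" where
  "Cop j k s T = (\<lambda>\<phi>. if \<phi> \<in> X then dist_mult (c j k s) T \<phi> else 0)"

definition Eop :: "nat \<Rightarrow> nat \<Rightarrow> nat \<Rightarrow> nat \<Rightarrow> 'n functional \<Rightarrow> 'n functional" where
  "Eop i j k s T = (\<lambda>\<phi>. if \<phi> \<in> X then dist_mult (p i (c j k s)) T \<phi> else 0)"

abbreviation "V \<equiv> additive_functionals U"

text \<open>Additivity merges the separate values in \<open>dist_diff_op\<close> into one, so the
  operator on functionals becomes composition with \<open>adj j\<close>.\<close>

lemma Pop_adj:
  assumes T: "T \<in> V" and \<phi>: "\<phi> \<in> X"
  shows "Pop j T \<phi> = T (adj j \<phi>)"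
proof -
  let ?\<psi> = "\<lambda>\<nu>. partial \<nu> (\<lambda>x. a j \<nu> x * \<phi> x)"
  have \<psi>: "?\<psi> \<nu> \<in> X" for \<nu>
    by (intro test_function_partial mult_X smooth_a \<phi>)
  have a0: "(\<lambda>x. a0 j x * \<phi> x) \<in> X" by (intro mult_X smooth_a0 \<phi>)
  have "Pop j T \<phi> = T (\<lambda>x. a0 j x * \<phi> x) - (\<Sum>\<nu>\<in>UNIV. T (?\<psi> \<nu>))"
    using \<phi> by (simp add: Pop_def dist_diff_op_def dist_mult_def dist_partial_def sum_negf)
  also have "\<dots> = T (\<lambda>x. a0 j x * \<phi> x - (\<Sum>\<nu>\<in>UNIV. ?\<psi> \<nu> x))"
    by (simp add: additive_functionals_sum[OF T, symmetric] \<psi>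
        additive_functionals_diff[OF T a0 test_function_sum, symmetric])
  also have "(\<lambda>x. a0 j x * \<phi> x - (\<Sum>\<nu>\<in>UNIV. ?\<psi> \<nu> x)) = adj j \<phi>"
    unfolding partial_mult_test[OF open_\<Omega> U_\<Omega> smooth_a \<phi>]
    by (rule ext) (simp add: adj_def d0_def
        divergence_def principal_op_def algebra_simps sum.distrib sum_distrib_left)
  finally show ?thesis .
qed

lemma Pop_V:
  assumes "T \<in> V"
  shows "Pop j T \<in> V"
  unfolding additive_functionals_def
  by (simp add: Pop_adj[OF assms] test_function_add adj_add adj_X
      additive_functionals_add[OF assms])

lemma Cop_V:
  assumes "T \<in> V"
  shows "Cop j k s T \<in> V"
  unfolding additive_functionals_def
  by (simp add: Cop_def dist_mult_def test_function_add distrib_left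
      additive_functionals_add[OF assms] mult_X smooth_c)

sublocale lie_algebroid_rep r Pop Cop Eop V
proof
  fix i j k l m s j' k' s' and S T :: "'n functional"
  show "Pop j (S + T) = Pop j S + Pop j T"
    by (rule ext) (simp add: Pop_def dist_diff_op_def dist_mult_def dist_partial_def sum_negf
        sum.distrib sum_subtractf algebra_simps)
  show "Cop j k s (S + T) = Cop j k s S + Cop j k s T"
    by (rule ext) (simp add: Cop_def dist_mult_def)
  show "Eop i j k s (S + T) = Eop i j k s S + Eop i j k s T"
    by (rule ext) (simp add: Eop_def dist_mult_def)
  show "Cop j k s (Cop j' k' s' T) = Cop j' k' s' (Cop j k s T)"
    by (rule ext) (simp add: Cop_def dist_mult_def mult_X smooth_c mult.left_commute)
  \<comment> \<open>The laws above are formal and hold for every functional; those below split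
    \<open>T\<close> over sums or negatives of test functions.\<close>
  assume T: "T \<in> V"
  \<comment> \<open>Antisymmetry of the coefficients is known only on \<open>\<Omega>\<close>; off
    \<open>U\<close> the factor \<open>\<phi>\<close> vanishes.\<close>
  have neg: "T (\<lambda>x. g x * \<phi> x) = - T (\<lambda>x. h x * \<phi> x)"
    if "\<And>x. x \<in> \<Omega> \<Longrightarrow> g x = - h x" "smooth_on \<Omega> h" "\<phi> \<in> X" for g h \<phi>
  proof -
    have "g x * \<phi> x = - (h x * \<phi> x)" for x
      using that(1)[of x] test_function_zero[OF that(3), of x] U_\<Omega> by (cases "x \<in> U") auto
    then show ?thesis using additive_functionals_minus[OF T mult_X[OF that(2,3)]] by simp
  qed
  show "Cop j k s T = - Cop k j s T"
  proof
    fix \<phi>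
    have "T (\<lambda>x. c j k s x * \<phi> x) = - T (\<lambda>x. c k j s x * \<phi> x)" if "\<phi> \<in> X"
      by (rule neg[OF antisym smooth_c that])
    then show "Cop j k s T \<phi> = (- Cop k j s T) \<phi>"
      by (simp only: Cop_def dist_mult_def uminus_apply split: if_split) simp
  qed
  show "Pop i (Cop j k s T) = Cop j k s (Pop i T) + Eop i j k s T"
  proof
    fix \<phi>
    show "Pop i (Cop j k s T) \<phi> = (Cop j k s (Pop i T) + Eop i j k s T) \<phi>"
    proof (cases "\<phi> \<in> X")
      case True
      have "Cop j k s (Pop i T) \<phi> + Eop i j k s T \<phi>
        = T (\<lambda>x. adj i (\<lambda>x. c j k s x * \<phi> x) x + p i (c j k s) x * \<phi> x)"
        using True by (simp add: Cop_def Eop_def dist_mult_def Pop_adj[OF T] mult_X smooth_c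
            additive_functionals_add[OF T] adj_X smooth_p)
      also have "\<dots> = T (\<lambda>x. c j k s x * adj i \<phi> x)"
        by (simp add: adj_mult[OF smooth_c True])
      also have "\<dots> = Pop i (Cop j k s T) \<phi>"
        unfolding Pop_adj[OF Cop_V[OF T] True] by (simp add: Cop_def dist_mult_def adj_X True)
      finally show ?thesis by simp
    qed (simp add: Pop_def Cop_def Eop_def)
  qed
  show "Pop j (Pop k T) - Pop k (Pop j T) = (\<Sum>s=1..r. Cop j k s (Pop s T))"
  proof
    fix \<phi>
    show "(Pop j (Pop k T) - Pop k (Pop j T)) \<phi> = (\<Sum>s=1..r. Cop j k s (Pop s T)) \<phi>"
    proof (cases "\<phi> \<in> X")
      case True
      have "Pop j (Pop k T) \<phi> - Pop k (Pop j T) \<phi>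
        = T (\<lambda>x. adj k (adj j \<phi>) x - adj j (adj k \<phi>) x)"
        using True by (simp add: Pop_adj[OF Pop_V[OF T]] Pop_adj[OF T] adj_X
            additive_functionals_diff[OF T])
      also have "\<dots> = (\<Sum>s=1..r. T (adj s (\<lambda>x. c j k s x * \<phi> x)))"
        unfolding adj_commutator[OF True]
        by (rule additive_functionals_sum[OF T]) (intro adj_X mult_X smooth_c True)
      also have "\<dots> = (\<Sum>s=1..r. Cop j k s (Pop s T)) \<phi>"
        using True by (simp add: sum_fun_eq Cop_def dist_mult_def Pop_adj[OF T] mult_X smooth_c)
      finally show ?thesis by simp
    qed (simp add: Pop_def Cop_def sum_fun_eq)
  qed
  show "(\<Sum>s=1..r. Cop j k s (Cop s m l T)) + (\<Sum>s=1..r. Cop j m s (Cop k s l T))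
        - (\<Sum>s=1..r. Cop k m s (Cop j s l T))
      = Eop m j k l T + Eop j k m l T - Eop k j m l T" (is "?L = ?R")
  proof
    fix \<phi>
    show "?L \<phi> = ?R \<phi>"
    proof (cases "\<phi> \<in> X")
      case True
      let ?c = "\<lambda>g x. g x * \<phi> x"
      have cc: "Cop j k s (Cop j' k' s' T) \<phi> = T (?c (\<lambda>x. c j k s x * c j' k' s' x))"
        for j k s j' k' s'
        using mult_X[OF smooth_c True] True by (simp add: Cop_def dist_mult_def mult.assoc mult.left_commute)
      have ccX: "?c (\<lambda>x. c j k s x * c j' k' s' x) \<in> X" for j k s j' k' s'
        by (intro mult_X smooth_on_mult open_\<Omega> smooth_c True)
      have eX: "?c (p i (c j k s)) \<in> X" for i j k s
        by (intro mult_X smooth_p smooth_c True)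
      have "?L \<phi> = T (\<lambda>x. (\<Sum>s=1..r. ?c (\<lambda>x. c j k s x * c s m l x) x)
          + (\<Sum>s=1..r. ?c (\<lambda>x. c j m s x * c k s l x) x)
          - (\<Sum>s=1..r. ?c (\<lambda>x. c k m s x * c j s l x) x))"
        using ccX by (simp add: sum_fun_eq cc additive_functionals_diff[OF T]
            additive_functionals_add[OF T] additive_functionals_sum[OF T]
            test_function_add test_function_sum)
      also have "\<dots> = T (\<lambda>x. ?c (p m (c j k l)) x + ?c (p j (c k m l)) x - ?c (p k (c j m l)) x)"
      proof (rule arg_cong[where f = T], rule ext)
        fix x
        show "(\<Sum>s=1..r. ?c (\<lambda>x. c j k s x * c s m l x) x)
          + (\<Sum>s=1..r. ?c (\<lambda>x. c j m s x * c k s l x) x)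
          - (\<Sum>s=1..r. ?c (\<lambda>x. c k m s x * c j s l x) x)
          = ?c (p m (c j k l)) x + ?c (p j (c k m l)) x - ?c (p k (c j m l)) x"
        proof (cases "x \<in> U")
          case False
          then show ?thesis using test_function_zero[OF True False] by simp
        next
          case True
          then have x: "x \<in> \<Omega>" using U_\<Omega> by blast
          \<comment> \<open>\<open>antisym\<close> holds on \<open>\<Omega>\<close> only, but a
            derivative at \<open>x\<close> depends only on values near \<open>x\<close>, and
            \<open>\<Omega>\<close> is open.\<close>
          have "p k (c m j l) x = p k (\<lambda>x. - c j m l x) x"
            unfolding principal_op_def
            by (intro sum.cong refl arg_cong2[where f = "(*)"] partial_cong[OF open_\<Omega> x] antisym)
          also have "\<dots> = - p k (c j m l) x"
            by (intro principal_op_minus diff smooth_c x)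
          finally have pk: "p k (c m j l) x = - p k (c j m l) x" .
          \<comment> \<open>Back to the cyclic form of (A2), with \<open>j\<close>,
            \<open>k\<close>, \<open>m\<close> in the roles of \<open>k\<close>, \<open>k'\<close>,
            \<open>l'\<close>.\<close>
          have "(\<Sum>s=1..r. c j k s x * c s m l x + c j m s x * c k s l x - c k m s x * c j s l x)
            = (\<Sum>s=1..r. c j k s x * c s m l x + c k m s x * c s j l x + c m j s x * c s k l x)"
            by (rule sum.cong[OF refl])
              (simp add: antisym[OF x, of m j] antisym[OF x, of _ j l] antisym[OF x, of _ k l])
          also have "\<dots> = p m (c j k l) x + p j (c k m l) x - p k (c j m l) x"
            unfolding jacobi[OF x] pk by simp
          finally have "(\<Sum>s=1..r. c j k s x * c s m l x + c j m s x * c k s l x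
              - c k m s x * c j s l x) * \<phi> x
            = (p m (c j k l) x + p j (c k m l) x - p k (c j m l) x) * \<phi> x" by simp
          then show ?thesis
            by (simp only: sum.distrib sum_subtractf sum_distrib_right left_diff_distrib distrib_right)
        qed
      qed
      also have "\<dots> = ?R \<phi>"
        using True eX by (simp add: Eop_def dist_mult_def additive_functionals_diff[OF T]
            additive_functionals_add[OF T] test_function_add)
      finally show ?thesis .
    qed (simp add: Cop_def Eop_def sum_fun_eq)
  qed
qed

text \<open>\<open>D_increasing\<close> for evaluation at \<open>\<phi>\<close>; on a test function
  the cut-offs in \<open>Pop\<close> and \<open>Cop\<close> are invisible.\<close>

lemma D_eq_complex_op_incr:
  assumes F: "alternating F" and J: "sorted J" "distinct J" and \<phi>: "\<phi> \<in> X"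
  shows "D J F \<phi> = complex_op_incr r a a0 c F J \<phi>"
proof -
  have e: "Modules.additive (\<lambda>T :: 'n functional. T \<phi>)" by standard simp
  have sgn: "sgn_perm J (m # n # list_minus J {m, n}) = inversion_sign (m # n # list_minus J {m, n})"
    if "m \<in> set J" "n \<in> set J" "m < n" for m n
    using that J by (intro sgn_perm_eq_inversion_sign) (auto simp: list_minus_def)
  have "D J F \<phi> = increasing_sum (\<lambda>j K. Pop j (F K) \<phi>)
    (\<lambda>m n K. \<Sum>s=1..r. Cop m n s (F (s # K)) \<phi>) J"
    by (rule D_increasing[OF e F J])
  also have "\<dots> = complex_op_incr r a a0 c F J \<phi>"
    unfolding increasing_sum_def complex_op_incr_def
    using \<phi> sgn by (auto simp: Pop_def Cop_def intro!: arg_cong2[where f = minus] sum.cong)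
  finally show ?thesis .
qed

text \<open>Both sides are antisymmetric, so agreement on sorted lists decides; on lists with a
  repeated entry both are 0.\<close>

lemma D_eq_complex_op:
  assumes F: "alternating F" "\<And>K. F K \<in> V" and q: "q \<le> r" and L: "L \<in> multi_indices r q"
    and \<phi>: "\<phi> \<in> X"
  shows "D L F \<phi> = complex_op r a a0 c q F L \<phi>"
proof -
  have alt: "alternating (\<lambda>L. D L F \<phi>)"
    unfolding alternating_def using alternating_swap[OF alternating_D[OF F]]
    by (metis uminus_apply)
  show ?thesis
  proof (cases "distinct L")
    case True
    then have "sgn_perm (sort L) L = inversion_sign L"
      by (intro sgn_perm_eq_inversion_sign) auto
    moreover have "D (sort L) F \<phi> = complex_op_incr r a a0 c F (sort L) \<phi>"
      using True by (intro D_eq_complex_op_incr F \<phi>) auto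
    ultimately show ?thesis
      using alternating_sort[OF alt True] True q L by (simp add: complex_op_def)
  next
    case False
    then show ?thesis using alternating_not_distinct[OF alt] by (simp add: complex_op_def)
  qed
qed

end

text \<open>A component of degree \<open>Suc k\<close>, evaluated at a test function, sees the
  family only at multi-indices of length \<open>k\<close> and at test functions, and the
  coefficients only at indices in \<open>1..r\<close>. This permits changing coefficients and family
  outside these ranges.\<close>

lemma complex_op_incr_cong:
  assumes J: "distinct J" "length J = Suc k" "set J \<subseteq> {1..r}" and \<phi>: "\<phi> \<in> test_functions U"
    and coeff: "\<And>j. j \<in> {1..r} \<Longrightarrow> a j = a' j" "\<And>j. j \<in> {1..r} \<Longrightarrow> a0 j = a0' j"
      "\<And>i j l. i \<in> {1..r} \<Longrightarrow> j \<in> {1..r} \<Longrightarrow> l \<in> {1..r} \<Longrightarrow> c i j l = c' i j l"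
    and X: "\<And>j \<nu> \<psi>. j \<in> {1..r} \<Longrightarrow> \<psi> \<in> test_functions U \<Longrightarrow> (\<lambda>x. a j \<nu> x * \<psi> x) \<in> test_functions U"
      "\<And>j \<psi>. j \<in> {1..r} \<Longrightarrow> \<psi> \<in> test_functions U \<Longrightarrow> (\<lambda>x. a0 j x * \<psi> x) \<in> test_functions U"
      "\<And>i j l \<psi>. i \<in> {1..r} \<Longrightarrow> j \<in> {1..r} \<Longrightarrow> l \<in> {1..r} \<Longrightarrow> \<psi> \<in> test_functions U \<Longrightarrow>
        (\<lambda>x. c i j l x * \<psi> x) \<in> test_functions U"
    and F: "\<And>I \<psi>. I \<in> multi_indices r k \<Longrightarrow> \<psi> \<in> test_functions U \<Longrightarrow> F I \<psi> = F' I \<psi>"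
  shows "complex_op_incr r a a0 c F J \<phi> = complex_op_incr r a' a0' c' F' J \<phi>"
proof -
  have len: "length (list_minus J A) = Suc k - card A" if "A \<subseteq> set J" for A
  proof -
    have "length (list_minus J A) = card (set (list_minus J A))"
      using J(1) by (simp add: distinct_card list_minus_def del: set_filter)
    also have "\<dots> = Suc k - card A"
      using that J(1,2) by (simp add: card_Diff_subset finite_subset distinct_card)
    finally show ?thesis .
  qed
  have 1: "dist_diff_op a a0 j (F (list_minus J {j})) \<phi> = dist_diff_op a' a0' j (F' (list_minus J {j})) \<phi>"
    if j: "j \<in> set J" for j
  proof -
    have jr: "j \<in> {1..r}" using j J(3) by blast
    have "list_minus J {j} \<in> multi_indices r k"
      using len[of "{j}"] j J(3) by (auto simp: multi_indices_def)
    then show ?thesis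
      using F X(1,2)[OF jr \<phi>] test_function_partial[where U = U]
      by (simp add: dist_diff_op_def dist_mult_def dist_partial_def coeff(1,2)[OF jr, symmetric])
  qed
  have 2: "dist_mult (c m n s) (F (s # list_minus J {m, n})) \<phi>
      = dist_mult (c' m n s) (F' (s # list_minus J {m, n})) \<phi>"
    if mn: "m \<in> set J" "n \<in> set J" "m < n" and s: "s \<in> {1..r}" for m n s
  proof -
    have mnr: "m \<in> {1..r}" "n \<in> {1..r}" using mn J(3) by auto
    \<comment> \<open>Two distinct entries force \<open>Suc k\<close> to be at least 2, so the
      truncated subtraction in \<open>len\<close> is exact and the list below has length
      \<open>k\<close>.\<close>
    have "1 \<le> k" using mn J(1,2) by (cases k) (auto simp: length_Suc_conv)
    then have "s # list_minus J {m, n} \<in> multi_indices r k"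
      using len[of "{m, n}"] mn s J(3) by (auto simp: multi_indices_def)
    then show ?thesis
      using F X(3)[OF mnr s \<phi>] by (simp add: dist_mult_def coeff(3)[OF mnr s, symmetric])
  qed
  show ?thesis
    unfolding complex_op_incr_def
    by (intro arg_cong2[where f = minus] sum.cong refl) (auto simp: 1 2 intro!: sum.cong)
qed

section \<open>Functionals given by \<open>L2_loc\<close> functions, and the final transfer\<close>

lemma dist_of_fun_additive:
  assumes "open U" "f \<in> L2_loc U" "\<phi> \<in> test_functions U" "\<psi> \<in> test_functions U"
  shows "dist_of_fun U f (\<lambda>x. \<phi> x + \<psi> x) = dist_of_fun U f \<phi> + dist_of_fun U f \<psi>"
  using integrable_L2_loc_test[OF assms(1,2)] assms(3,4)
  by (simp add: dist_of_fun_def distrib_left Bochner_Integration.integral_add)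

text \<open>Antisymmetry of \<open>f\<close> holds only almost everywhere; integration turns it into
  an exact identity.\<close>

lemma dist_of_fun_swap:
  assumes "open U" "f \<in> L2_loc_families U r k" "A @ x # y # B \<in> multi_indices r k"
    and \<phi>: "\<phi> \<in> test_functions U"
  shows "dist_of_fun U (f (A @ x # y # B)) \<phi> = - dist_of_fun U (f (A @ y # x # B)) \<phi>"
proof -
  let ?t = "Transposition.transpose (length A) (Suc (length A))"
  let ?I = "A @ y # x # B" and ?I' = "A @ x # y # B"
  have I: "?I \<in> multi_indices r k" using assms(3) by (auto simp: multi_indices_def)
  have "?t permutes {..<k}"
    using assms(3) by (intro permutes_swap_id) (auto simp: multi_indices_def)
  then have "AE x in lebesgue_on U. f (permute_list ?t ?I) x = of_int (sign ?t) * f ?I x"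
    using assms(2) I by (auto simp: L2_loc_families_def)
  then have ae: "AE x in lebesgue_on U. f ?I' x = - f ?I x"
    by (simp add: permute_list_swap sign_swap_id)
  have L2: "f ?I \<in> L2_loc U" "f ?I' \<in> L2_loc U"
    using assms(2,3) I by (auto simp: L2_loc_families_def)
  have "integral\<^sup>L (lebesgue_on U) (\<lambda>x. f ?I' x * \<phi> x) = integral\<^sup>L (lebesgue_on U) (\<lambda>x. - (f ?I x * \<phi> x))"
    using integrable_L2_loc_test[OF assms(1) L2(1) \<phi>] integrable_L2_loc_test[OF assms(1) L2(2) \<phi>] ae
    by (intro integral_cong_AE) (auto elim: eventually_mono)
  then show ?thesis by (simp add: dist_of_fun_def)
qed

theorem proposition2p1:
  fixes \<Omega> U :: "(real^'n::finite) set"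
    and r q :: nat
    and a :: "nat \<Rightarrow> 'n \<Rightarrow> real^'n \<Rightarrow> complex"
    and a0 :: "nat \<Rightarrow> real^'n \<Rightarrow> complex"
    and c :: "nat \<Rightarrow> nat \<Rightarrow> nat \<Rightarrow> real^'n \<Rightarrow> complex"
    and f :: "nat list \<Rightarrow> real^'n \<Rightarrow> complex"
  assumes "open \<Omega>"
    and "\<And>j \<nu>. j \<in> {1..r} \<Longrightarrow> smooth_on \<Omega> (a j \<nu>)"
    and "\<And>j. j \<in> {1..r} \<Longrightarrow> smooth_on \<Omega> (a0 j)"
    and "\<And>j k l. j \<in> {1..r} \<Longrightarrow> k \<in> {1..r} \<Longrightarrow> l \<in> {1..r} \<Longrightarrow> smooth_on \<Omega> (c j k l)"
    and A1_commutator: "\<And>j k u x. j \<in> {1..r} \<Longrightarrow> k \<in> {1..r} \<Longrightarrow> smooth_on \<Omega> u \<Longrightarrow> x \<in> \<Omega> \<Longrightarrow>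
      diff_op a a0 j (diff_op a a0 k u) x - diff_op a a0 k (diff_op a a0 j u) x
        = (\<Sum>l=1..r. c j k l x * diff_op a a0 l u x)"
    and A1_antisym: "\<And>j k l x. j \<in> {1..r} \<Longrightarrow> k \<in> {1..r} \<Longrightarrow> l \<in> {1..r} \<Longrightarrow> x \<in> \<Omega> \<Longrightarrow>
      c j k l x = - c k j l x"
    and A2: "\<And>k l k' l' x. k \<in> {1..r} \<Longrightarrow> l \<in> {1..r} \<Longrightarrow> k' \<in> {1..r} \<Longrightarrow> l' \<in> {1..r} \<Longrightarrow> x \<in> \<Omega> \<Longrightarrow>
      (\<Sum>s=1..r. c k k' s x * c s l' l x + c k' l' s x * c s k l x + c l' k s x * c s k' l x)
        = principal_op a l' (c k k' l) x + principal_op a k (c k' l' l) x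
          + principal_op a k' (c l' k l) x"
    and "1 \<le> q" and "q \<le> r"
    and "open U" and "U \<subseteq> \<Omega>"
    and "f \<in> L2_loc_families U r (q - 1)"
  shows "\<forall>L \<in> multi_indices r (q + 1). \<forall>\<phi> \<in> test_functions U.
    complex_op r a a0 c (q + 1) (complex_op r a a0 c q (\<lambda>I. dist_of_fun U (f I))) L \<phi> = 0"
proof (intro ballI)
  fix L \<phi> assume L: "L \<in> multi_indices r (q + 1)" and \<phi>: "\<phi> \<in> test_functions U"
  note smooth = assms(2-4)
  let ?R = "{1..r}"
  \<comment> \<open>Outside \<open>{1..r}\<close> the coefficients are arbitrary; setting them to \<open>0\<close> there makes the
    hypotheses hold for all indices.\<close>
  define a' where "a' j = (if j \<in> ?R then a j else (\<lambda>\<nu> x. 0))" for j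
  define a0' where "a0' j = (if j \<in> ?R then a0 j else (\<lambda>x. 0))" for j
  define c' where "c' j k l = (if j \<in> ?R \<and> k \<in> ?R \<and> l \<in> ?R then c j k l else (\<lambda>x. 0))" for j k l
  have in_range: "a' j = a j" "a0' j = a0 j" if "j \<in> ?R" for j
    using that by (simp_all add: a'_def a0'_def)
  have c_in_range: "c' j k l = c j k l" if "j \<in> ?R" "k \<in> ?R" "l \<in> ?R" for j k l
    using that by (simp add: c'_def)
  have p_in_range: "principal_op a' j = principal_op a j" "diff_op a' a0' j = diff_op a a0 j"
    if "j \<in> ?R" for j
    using in_range[OF that] by (simp_all add: principal_op_def diff_op_def fun_eq_iff)
  have out: "principal_op a' j u = (\<lambda>x. 0)" "diff_op a' a0' j u = (\<lambda>x. 0)"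
    if "j \<notin> ?R" for j u
    using that by (auto simp: principal_op_def diff_op_def fun_eq_iff a'_def a0'_def)
  have c_out: "c' j k l = (\<lambda>x. 0)" if "j \<notin> ?R \<or> k \<notin> ?R \<or> l \<notin> ?R" for j k l
    using that by (auto simp: c'_def)
  have p0: "diff_op a' a0' j (\<lambda>x. 0) = (\<lambda>x. 0)" for j
    by (simp add: diff_op_def fun_eq_iff)
  interpret involutive_frame \<Omega> U r a' a0' c'
  proof
    fix j k l k' l' u x and \<nu> :: 'n
    show "open \<Omega>" "U \<subseteq> \<Omega>" by fact+
    show "smooth_on \<Omega> (a' j \<nu>)" "smooth_on \<Omega> (a0' j)" "smooth_on \<Omega> (c' j k l)"
      using smooth by (auto simp: a'_def a0'_def c'_def smooth_on_const)
    assume x: "x \<in> \<Omega>"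
    show "c' j k l x = - c' k j l x"
      using A1_antisym[OF _ _ _ x, of j k l] by (simp add: c'_def)
    show "diff_op a' a0' j (diff_op a' a0' k u) x - diff_op a' a0' k (diff_op a' a0' j u) x
        = (\<Sum>l=1..r. c' j k l x * diff_op a' a0' l u x)" if u: "smooth_on \<Omega> u"
    proof (cases "j \<in> ?R \<and> k \<in> ?R")
      case True
      then show ?thesis
        using A1_commutator[OF _ _ u x, of j k] by (simp add: p_in_range c_in_range)
    next
      case False
      then show ?thesis by (auto simp: out c_out p0)
    qed
    show "(\<Sum>s=1..r. c' k k' s x * c' s l' l x + c' k' l' s x * c' s k l x + c' l' k s x * c' s k' l x)
        = principal_op a' l' (c' k k' l) x + principal_op a' k (c' k' l' l) x
          + principal_op a' k' (c' l' k l) x"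
    proof (cases "k \<in> ?R \<and> k' \<in> ?R \<and> l' \<in> ?R \<and> l \<in> ?R")
      case True
      then show ?thesis
        using A2[OF _ _ _ _ x, of k l k' l'] by (simp add: p_in_range c_in_range)
    next
      case False
      \<comment> \<open>Every product and every derivative in (A2) involves all four indices, so
        each vanishes as soon as one is out of range.\<close>
      then show ?thesis by (auto simp: out c_out)
    qed
  qed
  \<comment> \<open>Cutting off in both arguments makes alternation and additivity hold for all
    lists and all arguments, as \<open>D_D\<close> requires.\<close>
  define F where "F I = (\<lambda>\<psi>. if I \<in> multi_indices r (q - 1) \<and> \<psi> \<in> X
    then dist_of_fun U (f I) \<psi> else 0)" for I
  have L2: "f I \<in> L2_loc U" if "I \<in> multi_indices r (q - 1)" for I
    using \<open>f \<in> L2_loc_families U r (q - 1)\<close> that by (auto simp: L2_loc_families_def)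
  have FV: "F I \<in> V" for I
    by (auto simp: F_def additive_functionals_def test_function_add
        dist_of_fun_additive[OF \<open>open U\<close> L2])
  have F: "alternating F"
    unfolding alternating_def
  proof (intro allI ext)
    fix A x y B \<psi>
    have "A @ x # y # B \<in> multi_indices r (q - 1) \<longleftrightarrow> A @ y # x # B \<in> multi_indices r (q - 1)"
      by (auto simp: multi_indices_def)
    then show "F (A @ x # y # B) \<psi> = (- F (A @ y # x # B)) \<psi>"
      using dist_of_fun_swap[OF \<open>open U\<close> \<open>f \<in> L2_loc_families U r (q - 1)\<close>, of A x y B \<psi>]
      by (simp add: F_def)
  qed
  note cong = complex_op_incr_cong[where a = a and a' = a' and ?a0.0 = a0 and a0' = a0'
    and c = c and c' = c' and U = U and r = r,
    OF _ _ _ _ in_range(1)[symmetric] in_range(2)[symmetric] c_in_range[symmetric]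
    mult_X[OF smooth(1)] mult_X[OF smooth(2)] mult_X[OF smooth(3)]]
  let ?G = "complex_op r a a0 c q (\<lambda>I. dist_of_fun U (f I))"
  \<comment> \<open>\<open>?G\<close> and \<open>D\<close> agree only on test functions and on
    multi-indices of length \<open>q\<close>, which is all that the outer operator
    evaluates.\<close>
  have G: "?G I \<psi> = D I F \<psi>" if I: "I \<in> multi_indices r q" and \<psi>: "\<psi> \<in> X" for I \<psi>
  proof -
    have "?G I \<psi> = complex_op r a' a0' c' q F I \<psi>"
    proof (cases "distinct I")
      case True
      have "complex_op_incr r a a0 c (\<lambda>I. dist_of_fun U (f I)) (sort I) \<psi>
          = complex_op_incr r a' a0' c' F (sort I) \<psi>"
        using I \<psi> True \<open>1 \<le> q\<close>
        by (intro cong[where k = "q - 1"]) (auto simp: multi_indices_def F_def)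
      then show ?thesis by (simp add: complex_op_def)
    qed (simp add: complex_op_def)
    then show ?thesis using D_eq_complex_op[OF F FV \<open>q \<le> r\<close> I \<psi>] by simp
  qed
  show "complex_op r a a0 c (q + 1) ?G L \<phi> = 0"
  proof (cases "distinct L")
    case True
    \<comment> \<open>The component is shown to vanish without asking whether
      \<open>q + 1 \<le> r\<close>; for \<open>q = r\<close> the definition of
      \<open>complex_op\<close> already gives 0.\<close>
    have "complex_op_incr r a a0 c ?G (sort L) \<phi>
      = complex_op_incr r a' a0' c' (\<lambda>K. D K F) (sort L) \<phi>"
      using L \<phi> True by (intro cong[where k = q]) (auto simp: multi_indices_def G)
    also have "\<dots> = D (sort L) (\<lambda>K. D K F) \<phi>"
      using True by (intro D_eq_complex_op_incr[symmetric] alternating_D F FV \<phi>) auto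
    also have "\<dots> = 0"
      by (simp add: D_D[OF F FV])
    finally show ?thesis by (simp add: complex_op_def)
  qed (simp add: complex_op_def)
qed

end
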